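(* For every integer $d\ge 5$, $n(3;5,d)=2d+10$ if $d\equiv 0,1\pmod 5$, and $n(3;5,d)=2d+8$ if $d\equiv 2,3,4\pmod 5$. For $2\le d\le 4$, $n(3;5,d)=2d+6$.
   Context: All graphs are finite and simple. $n(3;5,d)$ denotes the minimum order of a $3$-regular graph of girth $5$ and diameter exactly $d$. *)

theory Defs
  imports "Graph_Theory.Graph_Theory" "HOL-Library.Extended_Nat"
begin

text \<open>
  A finite simple graph is a \<open>pair_graph\<close>: a finite, loop-free, symmetric digraph whose arcs are
  ordered pairs of vertices. An undirected edge is a pair of opposite arcs.
\<close>

context pre_digraph
begin

text \<open>
  By symmetry the out-degree of a vertex of a \<open>pair_graph\<close> is the number of its neighbours.
\<close>
definition regular :: "nat \<Rightarrow> bool" where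
  "regular k \<longleftrightarrow> (\<forall>v \<in> verts G. out_degree G v = k)"

text \<open>
  The bound on the length excludes the walks \<open>u, v, u\<close> along one edge, which count as cycles for
  digraphs. The girth of an acyclic graph is \<open>\<infinity>\<close>.
\<close>
definition girth :: enat where
  "girth = (INF p \<in> {p. cycle p \<and> 3 \<le> length p}. enat (length p))"

definition gdist :: "'a \<Rightarrow> 'a \<Rightarrow> enat" where
  "gdist u v = (INF p \<in> {p. awalk u p v}. enat (length p))"

text \<open>The diameter of a disconnected graph is \<open>\<infinity>\<close>.\<close>
definition diameter :: enat where
  "diameter = (SUP u \<in> verts G. SUP v \<in> verts G. gdist u v)"

end

lemma (in wf_digraph) ereal_of_enat_gdist:
  "ereal_of_enat (gdist u v) = \<mu> (\<lambda>_. 1) u v"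
proof (cases "{p. awalk u p v} = {}")
  case True
  then show ?thesis
    unfolding gdist_def \<mu>_def by (simp add: top_ereal_def top_enat_def)
next
  case False
  have cost: "awalk_cost (\<lambda>_. 1) p = real (length p)" for p
    by (induct p) auto
  let ?A = "(\<lambda>p. enat (length p)) ` {p. awalk u p v}"
  have "(LEAST x. x \<in> ?A) \<in> ?A"
    using False by (meson LeastI ex_in_conv image_is_empty)
  then have "gdist u v \<in> ?A"
    using False by (auto simp: gdist_def Inf_enat_def)
  then obtain q where q: "awalk u q v" "gdist u v = enat (length q)"
    by auto
  have "length q \<le> length p" if "awalk u p v" for p
    using that q(2) INF_lower[of p "{p. awalk u p v}" "\<lambda>p. enat (length p)"]
    by (simp add: gdist_def)
  then have "\<mu> (\<lambda>_. 1) u v = ereal (length q)"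
    unfolding \<mu>_def cost using q(1) by (intro INF_eqI) auto
  then show ?thesis
    using q(2) by simp
qed

text \<open>
  The least order of a \<open>k\<close>-regular graph of girth \<open>g\<close> and diameter \<open>d\<close>, or \<open>\<infinity>\<close> if there is no such
  graph. Every finite graph is isomorphic to one with vertices in \<^typ>\<open>nat\<close>.
\<close>
definition min_order :: "nat \<Rightarrow> nat \<Rightarrow> nat \<Rightarrow> enat" where
  "min_order k g d =
    (INF G \<in> {G :: nat pair_pre_digraph. pair_graph G
        \<and> pre_digraph.regular (with_proj G) k
        \<and> pre_digraph.girth (with_proj G) = enat g
        \<and> pre_digraph.diameter (with_proj G) = enat d}.
      enat (card (pverts G)))"

end

theory Submission
  imports Defs
begin

text \<open>
  Fix two vertices \<open>x\<close>, \<open>y\<close> at distance \<open>d\<close> and split the graph into distance layers from \<open>x\<close>. Girth 5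
  puts 10 vertices within distance 2 of \<open>x\<close> and of \<open>y\<close>, hence into the first and the last three layers,
  and at least 10 into any five consecutive layers in between: a layer of size 1 sends either two
  edges onwards and is followed by layers of sizes 2, 4, at least 2, or two edges back and is preceded
  by two layers that together have at least 6 vertices. Cutting the \<open>d - 5\<close> intermediate layers into
  blocks of five and using that a cubic graph has even order gives the lower bounds.

  Conversely, the Petersen graph minus an edge has 10 vertices, and its two vertices of degree 2 are
  at distance 4. Inserting it into a bridge raises the order by 10 and the diameter by 5. Joining by
  such a chain two pendant pieces with 11, 13, 19 or 21 vertices attains the bounds for \<open>d \<ge> 7\<close>, and
  one explicit graph does so for each \<open>d \<le> 6\<close>.
\<close>

section \<open>Distance layers of a cubic graph of girth at least 5\<close>

text \<open>The first condition excludes triangles and, for a = b = c, also loops. The second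
  excludes 4-cycles; its disjunction admits the closed walks that return along an edge.\<close>

definition girth_ge5 :: "'a rel \<Rightarrow> bool" where
  "girth_ge5 E \<longleftrightarrow>
    (\<forall>a b c. (a, b) \<in> E \<longrightarrow> (b, c) \<in> E \<longrightarrow> (c, a) \<notin> E) \<and>
    (\<forall>a b c d. (a, b) \<in> E \<longrightarrow> (b, c) \<in> E \<longrightarrow> (c, d) \<in> E \<longrightarrow> (d, a) \<in> E \<longrightarrow> a = c \<or> b = d)"

text \<open>Swapping components matches increasing arcs with decreasing ones; the linear order picks
  one arc from each opposite pair.\<close>

lemma even_card_irreflexive_symmetric:
  fixes E :: "'a :: linorder rel"
  assumes "finite E" "sym E" "irrefl E"
  shows "even (card E)"
proof -
  let ?A = "{(u, v) \<in> E. u < v}" and ?B = "{(u, v) \<in> E. v < u}"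
  have "E = ?A \<union> ?B"
    using assms(3) by (auto simp: irrefl_def) (metis linorder_neqE)
  moreover have "card (?A \<union> ?B) = card ?A + card ?B"
    by (rule card_Un_disjoint) (auto intro: finite_subset[OF _ assms(1)])
  moreover have "?B = prod.swap ` ?A"
    using assms(2) by (auto simp: image_iff dest: symD)
  then have "card ?B = card ?A"
    by (simp add: card_image)
  ultimately have "card E = 2 * card ?A"
    by simp
  then show ?thesis
    by simp
qed

text \<open>
  The level \<open>l v\<close> stands for the distance of \<open>v\<close> from one end of a diametral pair.
\<close>
locale cubic_layers =
  fixes V :: "'a :: linorder set" and E :: "'a rel" and l :: "'a \<Rightarrow> nat" and d :: nat
  assumes finite_V: "finite V"
    and E_subset: "E \<subseteq> V \<times> V"
    and sym_E: "sym E"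
    and girth_E: "girth_ge5 E"
    and degree: "v \<in> V \<Longrightarrow> card (E `` {v}) = 3"
    and level_step: "(u, v) \<in> E \<Longrightarrow> l u \<le> Suc (l v)"
    and parent_ex: "v \<in> V \<Longrightarrow> l v = Suc i \<Longrightarrow> \<exists>u. (u, v) \<in> E \<and> l u = i"
    and level_le: "v \<in> V \<Longrightarrow> l v \<le> d"
    and top_ex: "\<exists>v \<in> V. l v = d"
begin

definition L :: "nat \<Rightarrow> 'a set" where "L i = {v \<in> V. l v = i}"
abbreviation s :: "nat \<Rightarrow> nat" where "s i \<equiv> card (L i)"

lemma adj_sym: "(u, v) \<in> E \<Longrightarrow> (v, u) \<in> E"
  using sym_E by (auto dest: symD)

lemma triangle: "(a, b) \<in> E \<Longrightarrow> (b, c) \<in> E \<Longrightarrow> (c, a) \<in> E \<Longrightarrow> False"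
  using girth_E unfolding girth_ge5_def by blast

lemma irrefl_E: "(a, a) \<notin> E"
  using triangle by blast

lemma common_neighbour:
  "(a, b) \<in> E \<Longrightarrow> (c, b) \<in> E \<Longrightarrow> (a, b') \<in> E \<Longrightarrow> (c, b') \<in> E \<Longrightarrow> a = c \<or> b = b'"
  using girth_E adj_sym unfolding girth_ge5_def by blast

lemma adj_in_V: "(u, v) \<in> E \<Longrightarrow> u \<in> V \<and> v \<in> V"
  using E_subset by blast

text \<open>Handshake: there are \<open>3 * card V\<close> arcs, and they come in opposite
  pairs.\<close>

lemma even_card_V: "even (card V)"
proof -
  have fin: "finite E"
    using E_subset finite_V by (meson finite_SigmaI finite_subset)
  have "E = Sigma V (\<lambda>v. E `` {v})"
    using E_subset by auto
  then have "card E = (\<Sum>v\<in>V. card (E `` {v}))"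
    using finite_V fin by (metis card_SigmaI finite_Image)
  also have "\<dots> = 3 * card V"
    by (simp add: degree)
  finally have "card E = 3 * card V" .
  moreover have "even (card E)"
    by (rule even_card_irreflexive_symmetric) (use fin sym_E irrefl_E in \<open>auto simp: irrefl_def\<close>)
  ultimately show ?thesis
    by simp
qed

lemma finite_L [simp]: "finite (L i)"
  using finite_V by (simp add: L_def)

lemma mem_L: "v \<in> L i \<longleftrightarrow> v \<in> V \<and> l v = i"
  by (auto simp: L_def)

lemma finite_nbrs: "v \<in> V \<Longrightarrow> finite (E `` {v})"
  by (metis card.infinite degree zero_neq_numeral)

lemma adj_level:
  assumes "(u, v) \<in> E"
  shows "l v = Suc (l u) \<or> l v = l u \<or> Suc (l v) = l u"
  using level_step[OF assms] level_step[OF adj_sym[OF assms]] by linarith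

text \<open>Descent from layer d: a vertex of layer n + 1 has a parent in layer n.\<close>

lemma L_nonempty: "i \<le> d \<Longrightarrow> L i \<noteq> {}"
proof (induction rule: inc_induct)
  case base
  then show ?case using top_ex by (auto simp: L_def)
next
  case (step n)
  then obtain v where "v \<in> V" "l v = Suc n" by (auto simp: L_def)
  then show ?case
    using parent_ex adj_in_V by (fastforce simp: L_def)
qed

lemma s_pos: "i \<le> d \<Longrightarrow> s i \<ge> 1"
  using L_nonempty by (simp add: Suc_le_eq card_gt_0_iff)

section \<open>Vertices within distance two\<close>

text \<open>Two neighbours of a share only a, since otherwise there is a 4-cycle. So the pairs of
  further neighbours are disjoint. Taking a subset P allows counting on one side of a layer.\<close>

lemma card_second_nbrs:
  assumes "a \<in> V" "P \<subseteq> E `` {a}"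
  shows "card (\<Union>p\<in>P. E `` {p} - {a}) = 2 * card P"
proof -
  have fP: "finite P"
    using assms finite_nbrs finite_subset by blast
  have "card (\<Union>p\<in>P. E `` {p} - {a}) = (\<Sum>p\<in>P. card (E `` {p} - {a}))"
  proof (rule card_UN_disjoint[OF fP])
    show "\<forall>p\<in>P. finite (E `` {p} - {a})"
      using assms finite_nbrs adj_in_V by blast
    show "\<forall>p\<in>P. \<forall>q\<in>P. p \<noteq> q \<longrightarrow> (E `` {p} - {a}) \<inter> (E `` {q} - {a}) = {}"
      using assms common_neighbour adj_sym by blast
  qed
  also have "\<dots> = (\<Sum>p\<in>P. 2)"
  proof (rule sum.cong)
    fix p assume "p \<in> P"
    then have "(a, p) \<in> E" using assms by auto
    then have "a \<in> E `` {p}" "card (E `` {p}) = 3"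
      using adj_sym adj_in_V degree by blast+
    then show "card (E `` {p} - {a}) = 2" by simp
  qed simp
  finally show ?thesis by simp
qed

text \<open>Without triangles no second neighbour is itself a neighbour of a.\<close>

lemma card_two_ball:
  assumes "a \<in> V" "P \<subseteq> E `` {a}"
  shows "card (P \<union> (\<Union>p\<in>P. E `` {p} - {a})) = 3 * card P"
proof -
  have fP: "finite P"
    using assms finite_nbrs finite_subset by blast
  have "card (P \<union> (\<Union>p\<in>P. E `` {p} - {a})) = card P + card (\<Union>p\<in>P. E `` {p} - {a})"
  proof (rule card_Un_disjoint[OF fP])
    show "finite (\<Union>p\<in>P. E `` {p} - {a})"
      using fP assms finite_nbrs adj_in_V by blast
    show "P \<inter> (\<Union>p\<in>P. E `` {p} - {a}) = {}"
      using assms triangle adj_sym by blast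
  qed
  then show ?thesis
    using card_second_nbrs[OF assms] by simp
qed

text \<open>The Moore count 1 + 3 + 6; two steps change the level by at most 2.\<close>

lemma ball_card:
  assumes "v \<in> V"
  shows "card {u \<in> V. l u \<le> l v + 2 \<and> l v \<le> l u + 2} \<ge> 10"
proof -
  let ?P = "E `` {v}"
  let ?B = "?P \<union> (\<Union>p\<in>?P. E `` {p} - {v})"
  have 1: "card ?B = 9"
    using card_two_ball[of v ?P] assms degree by simp
  have "v \<notin> ?B" using irrefl_E by auto
  moreover have "finite ?B" using 1 by (metis card.infinite zero_neq_numeral)
  ultimately have "card (insert v ?B) = 10" using 1 by simp
  moreover have "insert v ?B \<subseteq> {u \<in> V. l u \<le> l v + 2 \<and> l v \<le> l u + 2}"
  proof
    fix u assume "u \<in> insert v ?B"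
    then consider "u = v" | "(v, u) \<in> E" | p where "(v, p) \<in> E" "(p, u) \<in> E"
      by blast
    then show "u \<in> {u \<in> V. l u \<le> l v + 2 \<and> l v \<le> l u + 2}"
    proof cases
      case 1 then show ?thesis using assms by simp
    next
      case 2 then show ?thesis using adj_level[OF 2] adj_in_V[OF 2] by auto
    next
      case 3 then show ?thesis using adj_level[of v p] adj_level[of p u] adj_in_V[of p u] by auto
    qed
  qed
  moreover have "finite {u \<in> V. l u \<le> l v + 2 \<and> l v \<le> l u + 2}"
    using finite_V by simp
  ultimately show ?thesis
    using card_mono[of "{u \<in> V. l u \<le> l v + 2 \<and> l v \<le> l u + 2}" "insert v ?B"] by simp
qed

section \<open>Layers of size one\<close>

text \<open>Every vertex of layer i + 1 needs a as its parent, so W is that whole layer. There is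
  nobody else in layer i, so the remaining edges of a go back.\<close>

lemma singleton_layer:
  assumes "s i = 1" "1 \<le> i" "i < d"
  obtains a U W where "L i = {a}" "E `` {a} = U \<union> W" "U \<subseteq> L (i - 1)" "W = L (i + 1)"
    "card U + card W = 3" "card U \<ge> 1" "card W \<ge> 1"
proof -
  obtain a where a: "L i = {a}" using assms(1) card_1_singletonE by blast
  then have aV: "a \<in> V" "l a = i" by (auto simp: L_def)
  define U where "U = E `` {a} \<inter> L (i - 1)"
  define W where "W = E `` {a} \<inter> L (i + 1)"
  have W: "W = L (i + 1)"
  proof -
    have "w \<in> E `` {a}" if "w \<in> L (i + 1)" for w
      using that parent_ex[of w i] a adj_in_V unfolding mem_L
      by (metis Image_singleton_iff Suc_eq_plus1 mem_L singletonD)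
    then show ?thesis unfolding W_def by blast
  qed
  have UW: "E `` {a} = U \<union> W"
  proof -
    have "w \<in> U \<union> W" if "(a, w) \<in> E" for w
    proof -
      have wV: "w \<in> V" using that adj_in_V by blast
      have "l w \<noteq> i" using that wV a irrefl_E by (metis mem_L singletonD)
      then have "l w = i + 1 \<or> l w = i - 1"
        using adj_level[OF that] aV by auto
      then show ?thesis using that wV unfolding U_def W_def by (auto simp: mem_L)
    qed
    then show ?thesis by (auto simp: U_def W_def)
  qed
  have "U \<inter> W = {}" using assms(2) by (auto simp: U_def W_def L_def)
  moreover have "finite U" "finite W" by (auto simp: U_def W_def)
  ultimately have c: "card U + card W = 3"
    using UW degree[OF aV(1)] by (simp add: card_Un_disjoint)
  have "W \<noteq> {}" using L_nonempty[of "i + 1"] W assms(3) by simp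
  moreover have "U \<noteq> {}"
    using parent_ex[of a "i - 1"] aV assms(2) adj_sym adj_in_V unfolding U_def mem_L
    by (fastforce simp: mem_L)
  ultimately show ?thesis
    using that[OF a UW _ W c] \<open>finite U\<close> \<open>finite W\<close> by (auto simp: U_def Suc_le_eq card_gt_0_iff)
qed

text \<open>By \<open>singleton_layer\<close>, an inner layer of this form sends one edge back and
  two onwards.\<close>

definition opens :: "nat \<Rightarrow> bool" where "opens i \<longleftrightarrow> s i = 1 \<and> s (i + 1) = 2"

text \<open>With only one edge onwards there are two edges back. Their two ends and the four further
  neighbours of these ends lie in the two preceding layers.\<close>

lemma singleton_layer_cases:
  assumes "s i = 1" "2 \<le> i" "i < d"
  shows "opens i \<or> s (i + 1) = 1 \<and> s (i - 1) + s (i - 2) \<ge> 6"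
proof -
  have "1 \<le> i" using assms by simp
  from singleton_layer[OF assms(1) this assms(3)]
  obtain a U W where a: "L i = {a}" "E `` {a} = U \<union> W" "U \<subseteq> L (i - 1)" "W = L (i + 1)"
    "card U + card W = 3" "card U \<ge> 1" "card W \<ge> 1" by metis
  have aV: "a \<in> V" "l a = i" using a(1) by (auto simp: L_def)
  consider "card W = 2" | "card W = 1" "card U = 2" using a by linarith
  then show ?thesis
  proof cases
    case 1 then show ?thesis using a assms by (simp add: opens_def)
  next
    case 2
    let ?B = "U \<union> (\<Union>p\<in>U. E `` {p} - {a})"
    have "?B \<subseteq> L (i - 1) \<union> L (i - 2)"
    proof
      fix x assume "x \<in> ?B"
      then consider "x \<in> U" | p where "p \<in> U" "(p, x) \<in> E" "x \<noteq> a" by blast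
      then show "x \<in> L (i - 1) \<union> L (i - 2)"
      proof cases
        case 1 then show ?thesis using a by blast
      next
        case 2
        then have "l p = i - 1" "x \<in> V" using a(3) adj_in_V by (auto simp: L_def)
        moreover have "l x \<noteq> i" using 2 \<open>x \<in> V\<close> a(1) by (metis mem_L singletonD)
        ultimately show ?thesis
          using adj_level[OF 2(2)] assms(2) by (auto simp: mem_L)
      qed
    qed
    then have "card ?B \<le> card (L (i - 1) \<union> L (i - 2))" by (intro card_mono) auto
    also have "\<dots> \<le> s (i - 1) + s (i - 2)" by (rule card_Un_le)
    finally have "6 \<le> s (i - 1) + s (i - 2)"
      using card_two_ball[OF aV(1), of U] a(2) 2 by simp
    then show ?thesis using 2 a by simp
  qed
qed

text \<open>The first of the two layers offers only one vertex to go back to, so two edges of the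
  second one go onwards.\<close>

lemma opens_if_two_singletons:
  assumes "s i = 1" "s (i + 1) = 1" "i + 1 < d"
  shows "opens (i + 1)"
proof -
  have "1 \<le> i + 1" by simp
  from singleton_layer[OF assms(2) this assms(3)]
  obtain a U W where a: "U \<subseteq> L i" "W = L (i + 1 + 1)" "card U + card W = 3" "card U \<ge> 1"
    by (metis add_diff_cancel_right')
  have "card U \<le> 1" using card_mono[OF finite_L a(1)] assms(1) by simp
  then have "card W = 2" using a(3,4) by linarith
  then show ?thesis unfolding opens_def a(2) using assms(2) by blast
qed

text \<open>
  A vertex of layer \<open>i + 2\<close> has one parent and at most one neighbour in its own layer. Hence each of
  the four has a child, and a single vertex cannot be the child of all four.
\<close>
lemma opens_next:
  assumes "opens i" "1 \<le> i" "i < d"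
  shows "s (i + 2) = 4" "i + 3 \<le> d \<Longrightarrow> s (i + 3) \<ge> 2"
proof -
  have "s i = 1" using assms by (simp add: opens_def)
  from singleton_layer[OF this assms(2,3)]
  obtain a U W where a: "L i = {a}" "E `` {a} = U \<union> W" "U \<subseteq> L (i - 1)" "W = L (i + 1)"
    "card U + card W = 3" by metis
  have aV: "a \<in> V" "l a = i" using a(1) by (auto simp: L_def)
  have cW: "card W = 2" using a assms by (simp add: opens_def)
  have WN: "W \<subseteq> E `` {a}" using a by blast
  define X where "X = (\<Union>p\<in>W. E `` {p} - {a})"
  have X: "X = L (i + 2)"
  proof
    show "X \<subseteq> L (i + 2)"
    proof
      fix x assume "x \<in> X"
      then obtain p where p: "p \<in> W" "(p, x) \<in> E" "x \<noteq> a" by (auto simp: X_def)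
      then have "l p = i + 1" "x \<in> V" using a(4) adj_in_V by (auto simp: L_def)
      moreover have "l x \<noteq> i" using p(3) \<open>x \<in> V\<close> a(1) by (metis mem_L singletonD)
      moreover have "l x \<noteq> i + 1"
      proof
        assume "l x = i + 1"
        then have "x \<in> W" using \<open>x \<in> V\<close> a(4) by (simp add: mem_L)
        then have "(a, x) \<in> E" "(a, p) \<in> E" using WN p by auto
        then show False using triangle p adj_sym by blast
      qed
      ultimately show "x \<in> L (i + 2)" using adj_level[OF p(2)] by (auto simp: mem_L)
    qed
    show "L (i + 2) \<subseteq> X"
    proof
      fix x assume x: "x \<in> L (i + 2)"
      then obtain p where p: "(p, x) \<in> E" "l p = i + 1"
        using parent_ex[of x "i + 1"] by (auto simp: mem_L)
      then have "p \<in> W" using a(4) adj_in_V by (auto simp: mem_L)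
      then show "x \<in> X" using p x aV by (auto simp: X_def mem_L)
    qed
  qed
  show s2: "s (i + 2) = 4"
    using card_second_nbrs[OF aV(1) WN] cW X by (simp add: X_def)
  show "s (i + 3) \<ge> 2" if "i + 3 \<le> d"
  proof (rule ccontr)
    assume "\<not> 2 \<le> s (i + 3)"
    then have "s (i + 3) = 1" using s_pos[OF that] by linarith
    then obtain b where b: "L (i + 3) = {b}" using card_1_singletonE by blast
    then have bV: "b \<in> V" by (auto simp: L_def)
    have "(x, b) \<in> E" if xX: "x \<in> X" for x
    proof (rule ccontr)
      assume nb: "(x, b) \<notin> E"
      obtain p q where pq: "W = {p, q}" "p \<noteq> q" "(p, x) \<in> E"
        using xX cW unfolding X_def by (auto simp: card_2_iff doubleton_eq_iff)
      have pa: "(a, p) \<in> E" "(a, q) \<in> E" using pq WN by auto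
      have xV: "x \<in> V" "l x = i + 2" using xX X by (auto simp: mem_L)
      have qx: "(q, x) \<notin> E" using common_neighbour[of p a q x] pq pa adj_sym xV aV by auto
      \<comment> \<open>Without a child, x has only p and neighbours of q as its neighbours. Two of
        the latter close a 4-cycle with x and q.\<close>
      have y: "y = p \<or> y \<in> X \<and> (q, y) \<in> E" if xy: "(x, y) \<in> E" for y
      proof -
        have yV: "y \<in> V" using xy adj_in_V by blast
        have "y \<noteq> b" using nb xy by auto
        then have "l y \<noteq> i + 3" using b yV by (metis mem_L singletonD)
        then consider "l y = i + 1" | "l y = i + 2" using adj_level[OF xy] xV by linarith
        then show ?thesis
        proof cases
          case 1
          then have "y \<in> W" using a(4) yV by (simp add: mem_L)
          then show ?thesis using pq qx xy adj_sym by blast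
        next
          case 2
          then have "y \<in> X" using X yV by (simp add: mem_L)
          moreover have "(p, y) \<notin> E" using triangle pq xy adj_sym by blast
          ultimately show ?thesis using pq unfolding X_def by auto
        qed
      qed
      have c3: "card (E `` {x}) = 3" using xV degree by blast
      then obtain y1 y2 y3 where e: "E `` {x} = {y1, y2, y3}" "y1 \<noteq> y2" "y2 \<noteq> y3" "y1 \<noteq> y3"
        by (auto simp: card_3_iff)
      then have "(x, y1) \<in> E" "(x, y2) \<in> E" "(x, y3) \<in> E" by blast+
      then obtain y z where "(x, y) \<in> E" "(x, z) \<in> E" "y \<noteq> z" "(q, y) \<in> E" "(q, z) \<in> E"
        using y e(2-4) by metis
      then have "x = q" using common_neighbour[of x y q z] by blast
      then show False using xV pq a(4) by (auto simp: mem_L set_eq_iff)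
    qed
    then have "X \<subseteq> E `` {b}" using adj_sym by blast
    then have "card X \<le> 3" using card_mono[OF finite_nbrs[OF bV]] degree[OF bV] by metis
    then show False using s2 X by simp
  qed
qed

text \<open>Let p be the neighbour of a in layer i - 1 and q the other vertex there. If layer i - 2
  had at most two vertices, q would need all of them and p as neighbours. But p has a third
  neighbour besides a and q, also in layer i - 2, which gives a triangle.\<close>

lemma opens_prev:
  assumes "opens i" "2 \<le> i" "i < d" "s (i - 1) = 2"
  shows "s (i - 2) \<ge> 3"
proof (rule ccontr)
  assume ns: "\<not> 3 \<le> s (i - 2)"
  have "s i = 1" "1 \<le> i" using assms by (simp_all add: opens_def)
  from singleton_layer[OF this assms(3)]
  obtain a U W where a: "L i = {a}" "E `` {a} = U \<union> W" "U \<subseteq> L (i - 1)" "W = L (i + 1)"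
    "card U + card W = 3" by metis
  have aV: "a \<in> V" "l a = i" using a(1) by (auto simp: L_def)
  have "card U = 1" using a assms by (simp add: opens_def)
  then obtain p where p: "U = {p}" using card_1_singletonE by blast
  have "p \<in> L (i - 1)" using a p by blast
  moreover obtain q1 q2 where "L (i - 1) = {q1, q2}" "q1 \<noteq> q2"
    using assms(4) by (meson card_2_iff)
  ultimately obtain q where q: "L (i - 1) = {p, q}" "p \<noteq> q"
    by (metis insert_commute insert_iff singletonD)
  have "p \<in> L (i - 1)" "q \<in> L (i - 1)" using q by auto
  then have pV: "p \<in> V" "q \<in> V" "l p = i - 1" "l q = i - 1" by (simp_all add: mem_L)
  have "q \<notin> W" using pV a(4) by (simp add: mem_L)
  then have "q \<notin> E `` {a}"
    unfolding a(2) using p q(2) by simp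
  then have aN: "(a, q) \<notin> E" by simp
  have nb: "x \<in> {p, q, a} \<union> L (i - 2)" if "y \<in> {p, q}" "(y, x) \<in> E" for x y
  proof -
    have xV: "x \<in> V" using that adj_in_V by blast
    have "l y = i - 1" using that pV by auto
    then have "l x = i \<or> l x = i - 1 \<or> l x = i - 2"
      using adj_level[OF that(2)] assms(2) by auto
    then have "x \<in> L i \<union> L (i - 1) \<union> L (i - 2)" using xV by (auto simp: mem_L)
    then show ?thesis using a(1) q by auto
  qed
  have Nq: "E `` {q} \<subseteq> insert p (L (i - 2))"
    using nb[of q] aN irrefl_E[of q] adj_sym[of q a] by blast
  have "card (insert p (L (i - 2))) \<le> 3"
    using ns by (simp add: card_insert_if)
  then have Nq': "E `` {q} = insert p (L (i - 2))"
    using Nq card_subset_eq[of "insert p (L (i - 2))" "E `` {q}"] degree[OF pV(2)]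
      card_mono[OF _ Nq] by simp
  have "\<not> E `` {p} \<subseteq> {a, q}"
    using degree[OF pV(1)] card_mono[of "{a, q}" "E `` {p}"] by (auto simp: card_insert_if split: if_splits)
  then obtain x where x: "(p, x) \<in> E" "x \<noteq> a" "x \<noteq> q" by auto
  then have "x \<in> L (i - 2)" using nb[of p x] irrefl_E by auto
  then have "(q, x) \<in> E" "(q, p) \<in> E" using Nq' by blast+
  then show False using triangle x adj_sym by blast
qed

text \<open>The first layer of size 1 among the five, together with its direction, decides the bound.\<close>
lemma five_layers:
  assumes "3 \<le> i" "i + 7 \<le> d"
  shows "(\<Sum>j=i..<i+5. s j) \<ge> 10"
proof -
  have sum: "(\<Sum>j=i..<i+5. s j) = s i + s (i+1) + s (i+2) + s (i+3) + s (i+4)"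
    by (simp add: numeral_eq_Suc)
  have p: "s i \<ge> 1" "s (i+1) \<ge> 1" "s (i+2) \<ge> 1" "s (i+3) \<ge> 1" "s (i+4) \<ge> 1"
    using assms s_pos[of i] s_pos[of "i+1"] s_pos[of "i+2"] s_pos[of "i+3"] s_pos[of "i+4"] by simp_all
  have cases: "s j = 1 \<Longrightarrow> opens j \<or> s (j + 1) = 1 \<and> opens (j + 1) \<and> s (j - 1) + s (j - 2) \<ge> 6"
    if "2 \<le> j" "j + 1 < d" for j
    using singleton_layer_cases[of j] opens_if_two_singletons[of j] that by auto
  have op: "s j = 1 \<and> s (j+1) = 2 \<and> s (j + 2) = 4" if "opens j" "2 \<le> j" "j < d" for j
    using opens_next[of j] that by (auto simp: opens_def)
  have op3: "s (j + 3) \<ge> 2" if "opens j" "2 \<le> j" "j + 3 \<le> d" for j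
    using opens_next[of j] that by auto
  have pr: "s (j - 1) \<noteq> 2 \<or> s (j - 2) \<ge> 3" if "opens j" "2 \<le> j" "j < d" for j
    using opens_prev[of j] that by auto
  consider "s i = 1" | "s i \<ge> 2" "s (i+1) = 1" | "s i \<ge> 2" "s (i+1) \<ge> 2" "s (i+2) = 1"
    | "s i \<ge> 2" "s (i+1) \<ge> 2" "s (i+2) \<ge> 2" "s (i+3) = 1"
    | "s i \<ge> 2" "s (i+1) \<ge> 2" "s (i+2) \<ge> 2" "s (i+3) \<ge> 2" "s (i+4) = 1"
    | "s i \<ge> 2" "s (i+1) \<ge> 2" "s (i+2) \<ge> 2" "s (i+3) \<ge> 2" "s (i+4) \<ge> 2"
    using p by linarith
  then show ?thesis
  proof cases
    \<comment> \<open>The sizes are 1, 2, 4, at least 2, at least 1 if layer i opens, and 1, 1, 2,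
      4, at least 2 otherwise.\<close>
    case 1
    then show ?thesis unfolding sum
      using cases[of i] op[of i] op3[of i] op[of "i+1"] op3[of "i+1"] p assms
      by (auto simp: eval_nat_numeral)
  next
    case 2
    then show ?thesis unfolding sum
      using cases[of "i+1"] op[of "i+1"] op3[of "i+1"] op[of "i+2"] p assms
      by (auto simp: eval_nat_numeral)
  next
    case 3
    then show ?thesis unfolding sum
      using cases[of "i+2"] op[of "i+2"] op[of "i+3"] p assms
      by (auto simp: eval_nat_numeral)
  next
    \<comment> \<open>If layer i + 3 opens, one of the two layers before it has size at least 3 by
      \<open>pr\<close>, which gives 2 + 5 + 1 + 2. Otherwise these two have 6 vertices together,
      which gives 2 + 6 + 1 + 1.\<close>
    case 4
    then show ?thesis unfolding sum
      using cases[of "i+3"] op[of "i+3"] pr[of "i+3"] op[of "i+4"] p assms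
      by (auto simp: eval_nat_numeral)
  next
    case 5
    then show ?thesis unfolding sum
      using cases[of "i+4"] op[of "i+4"] pr[of "i+4"] p assms
      by (auto simp: eval_nat_numeral)
  next
    case 6
    then show ?thesis unfolding sum by linarith
  qed
qed

text \<open>After two layers of size 1 the second one opens, so there are never three in a row. The
  one vertex gained over the trivial bound 4 settles, with parity, the case
  \<open>d mod 5 = 4\<close>.\<close>

lemma four_layers:
  assumes "3 \<le> i" "i + 6 \<le> d"
  shows "(\<Sum>j=i..<i+4. s j) \<ge> 5"
proof -
  have "\<not> (s i = 1 \<and> s (i + 1) = 1 \<and> s (i + 2) = 1)"
    using opens_if_two_singletons[of i] assms by (auto simp: opens_def)
  moreover have "s i \<ge> 1" "s (i+1) \<ge> 1" "s (i+2) \<ge> 1" "s (i+3) \<ge> 1"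
    using assms s_pos[of i] s_pos[of "i+1"] s_pos[of "i+2"] s_pos[of "i+3"] by simp_all
  moreover have "(\<Sum>j=i..<i+4. s j) = s i + s (i+1) + s (i+2) + s (i+3)"
    by (simp add: numeral_eq_Suc)
  ultimately show ?thesis
    by linarith
qed

section \<open>Sums over all layers and the lower bounds\<close>

lemma card_layers: "card {v \<in> V. i \<le> l v \<and> l v < k} = (\<Sum>j=i..<k. s j)"
proof -
  have "{v \<in> V. i \<le> l v \<and> l v < k} = (\<Union>j\<in>{i..<k}. L j)"
    by (auto simp: L_def)
  then show ?thesis
    by (simp add: card_UN_disjoint) (subst card_UN_disjoint, auto simp: L_def finite_V)
qed

lemma card_V: "card V = (\<Sum>j=0..<d+1. s j)"
proof -
  have "{v \<in> V. 0 \<le> l v \<and> l v < d + 1} = V"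
    using level_le by (auto simp: less_Suc_eq_le)
  then show ?thesis using card_layers[of 0 "d + 1"] by simp
qed

lemma first_layers: "(\<Sum>j=0..<3. s j) \<ge> 10"
proof -
  obtain x where x: "x \<in> V" "l x = 0"
    using L_nonempty[of 0] by (auto simp: L_def)
  have "{u \<in> V. l u \<le> l x + 2 \<and> l x \<le> l u + 2} = {u \<in> V. 0 \<le> l u \<and> l u < 3}"
    using x by auto
  then show ?thesis
    using ball_card[OF x(1)] card_layers[of 0 3] by simp
qed

lemma last_layers:
  assumes "2 \<le> d"
  shows "(\<Sum>j=d-2..<d+1. s j) \<ge> 10"
proof -
  obtain y where y: "y \<in> V" "l y = d" using top_ex by blast
  have "{u \<in> V. l u \<le> l y + 2 \<and> l y \<le> l u + 2} = {u \<in> V. d - 2 \<le> l u \<and> l u < d + 1}"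
    using y level_le by fastforce
  then show ?thesis
    using ball_card[OF y(1)] card_layers[of "d - 2" "d + 1"] by simp
qed

lemma middle_layers: "i \<ge> 3 \<Longrightarrow> i + 5 * k + 2 \<le> d \<Longrightarrow> (\<Sum>j=i..<i+5*k. s j) \<ge> 10 * k"
proof (induction k)
  case (Suc k)
  have "(\<Sum>j=i..<i+5*Suc k. s j) = (\<Sum>j=i..<i+5*k. s j) + (\<Sum>j=i+5*k..<i+5*k+5. s j)"
    using sum.atLeastLessThan_concat[of i "i+5*k" "i+5*k+5" s] by (simp add: ac_simps)
  moreover have "(\<Sum>j=i+5*k..<i+5*k+5. s j) \<ge> 10"
    using Suc.prems by (intro five_layers) auto
  ultimately show ?case using Suc by simp
qed simp

text \<open>The d + 1 = 6 + 5k + r layers are the first three, k blocks of five, r remaining ones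
  and the last three.\<close>

lemma order_ge_long:
  assumes "d = 5 + 5 * k + r"
  shows "20 + 10 * k + (\<Sum>j=3+5*k..<3+5*k+r. s j) \<le> card V"
proof -
  have "card V = (\<Sum>j=0..<3. s j) + (\<Sum>j=3..<d+1. s j)"
    unfolding card_V using assms by (simp add: sum.atLeastLessThan_concat)
  also have "(\<Sum>j=3..<d+1. s j) = (\<Sum>j=3..<3+5*k. s j) + (\<Sum>j=3+5*k..<d+1. s j)"
    using assms by (simp add: sum.atLeastLessThan_concat)
  also have "(\<Sum>j=3+5*k..<d+1. s j) = (\<Sum>j=3+5*k..<3+5*k+r. s j) + (\<Sum>j=d-2..<d+1. s j)"
    using assms sum.atLeastLessThan_concat[of "3+5*k" "d-2" "d+1" s] by (simp add: ac_simps)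
  finally show ?thesis
    using first_layers last_layers middle_layers[of 3 k] assms by auto
qed

lemma sum_layers_ge: "k \<le> d + 1 \<Longrightarrow> k - i \<le> (\<Sum>j=i..<k. s j)"
  using sum_mono[of "{i..<k}" "\<lambda>_. 1" s] s_pos by auto

text \<open>For remainder 0 the bound 20 + 10k already equals 2d + 10. For remainder 1 the extra
  layer gives 21 + 10k, and parity raises this to 22 + 10k = 2d + 10.\<close>

lemma order_ge_mod01:
  assumes "5 \<le> d" "d mod 5 \<in> {0, 1}"
  shows "2 * d + 10 \<le> card V"
proof -
  \<comment> \<open>The two ends take six of the d + 1 layers; the other d - 5 contain this many
    full blocks of five.\<close>
  define k where "k = d div 5 - 1"
  have k: "d = 5 + 5 * k + d mod 5"
    using assms(1) by (auto simp: k_def) presburger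
  obtain m where m: "card V = 2 * m"
    using even_card_V by (rule evenE)
  have "d mod 5 \<le> (\<Sum>j=3+5*k..<3+5*k+d mod 5. s j)"
    using sum_layers_ge[of "3 + 5 * k + d mod 5" "3 + 5 * k"] k by linarith
  then have "20 + 10 * k + d mod 5 \<le> card V"
    using order_ge_long[OF k] by linarith
  then have "20 + 10 * k + d mod 5 \<le> 2 * m" unfolding m .
  consider "d mod 5 = 0" | "d mod 5 = 1" using assms(2) by auto
  then show ?thesis
  proof cases
    case 1
    then show ?thesis using k \<open>20 + 10 * k + d mod 5 \<le> 2 * m\<close> unfolding m by linarith
  next
    case 2
    then have "11 + 5 * k \<le> m" using \<open>20 + 10 * k + d mod 5 \<le> 2 * m\<close> by linarith
    then show ?thesis using k 2 unfolding m by linarith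
  qed
qed

text \<open>The counts for remainders 2, 3, 4 are 22, 23 and 25, each plus 10k; parity raises the
  last two to 24 and 26.\<close>

lemma order_ge_mod234:
  assumes "5 \<le> d" "d mod 5 \<in> {2, 3, 4}"
  shows "2 * d + 8 \<le> card V"
proof -
  define k where "k = d div 5 - 1"
  have k: "d = 5 + 5 * k + d mod 5"
    using assms(1) by (auto simp: k_def) presburger
  obtain m where m: "card V = 2 * m"
    using even_card_V by (rule evenE)
  have "d mod 5 \<le> (\<Sum>j=3+5*k..<3+5*k+d mod 5. s j)"
    using sum_layers_ge[of "3 + 5 * k + d mod 5" "3 + 5 * k"] k by linarith
  moreover have "5 \<le> (\<Sum>j=3+5*k..<3+5*k+d mod 5. s j)" if "d mod 5 = 4"
    using four_layers[of "3 + 5 * k"] k unfolding that by linarith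
  ultimately have "20 + 10 * k + d mod 5 \<le> card V" "d mod 5 = 4 \<Longrightarrow> 25 + 10 * k \<le> card V"
    using order_ge_long[OF k] by linarith+
  then have *: "20 + 10 * k + d mod 5 \<le> 2 * m" "d mod 5 = 4 \<Longrightarrow> 25 + 10 * k \<le> 2 * m"
    unfolding m by simp_all
  consider "d mod 5 = 2" | "d mod 5 = 3" | "d mod 5 = 4"
    using assms(2) by auto
  then show ?thesis
  proof cases
    case 1
    then show ?thesis using k *(1) unfolding m by linarith
  next
    case 2
    then have "12 + 5 * k \<le> m" using *(1) by linarith
    then show ?thesis using k 2 unfolding m by linarith
  next
    case 3
    then have "13 + 5 * k \<le> m" using *(2) by linarith
    then show ?thesis using k 3 unfolding m by linarith
  qed
qed

text \<open>Beyond the ten vertices of the first three layers, parity does the rest for d = 3. For d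
  = 4, layers 3 and 4 cannot both have size 1, as the top vertex would have at most one neighbour;
  so there are at least 13 vertices, hence 14.\<close>

lemma order_ge_short:
  assumes "2 \<le> d" "d \<le> 4"
  shows "2 * d + 6 \<le> card V"
proof -
  obtain m where m: "card V = 2 * m"
    using even_card_V by (rule evenE)
  have split: "card V = (\<Sum>j=0..<3. s j) + (\<Sum>j=3..<d+1. s j)"
    unfolding card_V using assms sum.atLeastLessThan_concat[of 0 3 "d+1" s] by linarith
  consider "d = 2" | "d = 3" | "d = 4" using assms by linarith
  then show ?thesis
  proof cases
    case 1
    then show ?thesis using split first_layers by simp
  next
    case 2
    then have "(\<Sum>j=3..<d+1. s j) = s 3"
      by (simp add: numeral_eq_Suc)
    then have "card V \<ge> 11" using split first_layers s_pos[of 3] 2 by linarith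
    then have "6 \<le> m" unfolding m by linarith
    then show ?thesis unfolding m 2 by linarith
  next
    case 3
    have "\<not> (s 3 = 1 \<and> s 4 = 1)"
    proof
      assume s: "s 3 = 1 \<and> s 4 = 1"
      then obtain a b where ab: "L 3 = {a}" "L 4 = {b}" by (meson card_1_singletonE)
      then have b: "b \<in> V" "l b = 4" by (auto simp: L_def)
      have "E `` {b} \<subseteq> {a}"
      proof
        fix x assume "x \<in> E `` {b}"
        then have x: "(b, x) \<in> E" "x \<in> V" "x \<noteq> b" using adj_in_V irrefl_E by auto
        then have "x \<in> L 3 \<or> x \<in> L 4"
          using adj_level[OF x(1)] level_le[OF x(2)] b 3 by (auto simp: mem_L)
        then show "x \<in> {a}" using ab x by auto
      qed
      then have "card (E `` {b}) \<le> 1"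
        using card_mono[of "{a}"] by simp
      then show False using degree[OF b(1)] by simp
    qed
    moreover have "(\<Sum>j=3..<d+1. s j) = s 3 + s 4"
      using 3 by (simp add: numeral_eq_Suc)
    ultimately have "card V \<ge> 13"
      using split first_layers s_pos[of 3] s_pos[of 4] 3 by linarith
    then have "7 \<le> m" unfolding m by linarith
    then show ?thesis unfolding m 3 by linarith
  qed
qed

end

section \<open>Joining graphs by a bridge\<close>

text \<open>Distance at most k, by relational powers, so that bridges and adjacency lists can be
  treated without walks.\<close>

definition near :: "'a rel \<Rightarrow> nat \<Rightarrow> 'a \<Rightarrow> 'a \<Rightarrow> bool" where
  "near E k u v \<longleftrightarrow> (\<exists>j\<le>k. (u, v) \<in> E ^^ j)"

lemma near_refl [simp]: "near E k u u"
  unfolding near_def by (rule exI[of _ 0]) simp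

lemma near_edge: "(u, v) \<in> E \<Longrightarrow> near E 1 u v"
  unfolding near_def by (rule exI[of _ 1]) simp

lemma near_mono: "near E j u v \<Longrightarrow> j \<le> k \<Longrightarrow> near E k u v"
  unfolding near_def using le_trans by blast

lemma near_trans:
  assumes "near E j u v" "near E k v w"
  shows "near E (j + k) u w"
proof -
  obtain a b where "a \<le> j" "(u, v) \<in> E ^^ a" "b \<le> k" "(v, w) \<in> E ^^ b"
    using assms unfolding near_def by blast
  then have "(u, w) \<in> E ^^ (a + b)" "a + b \<le> j + k"
    by (auto simp: relpow_add)
  then show ?thesis unfolding near_def by blast
qed

lemma relpow_image:
  assumes "\<And>x y. (x, y) \<in> E \<Longrightarrow> (h x, h y) \<in> F" "(u, v) \<in> E ^^ j"
  shows "(h u, h v) \<in> F ^^ j"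
  using assms(2) by (induction j arbitrary: v) (auto intro: assms(1))

lemma near_image:
  assumes "\<And>x y. (x, y) \<in> E \<Longrightarrow> (h x, h y) \<in> F" "near E k u v"
  shows "near F k (h u) (h v)"
  using assms(2) relpow_image[of E h F, OF assms(1)] unfolding near_def by blast

lemma sym_relpow: "sym E \<Longrightarrow> sym (E ^^ j)"
proof (induction j)
  case (Suc j)
  show ?case
  proof (rule symI)
    fix u v assume "(u, v) \<in> E ^^ Suc j"
    then obtain w where "(u, w) \<in> E ^^ j" "(w, v) \<in> E" by auto
    then have "(w, u) \<in> E ^^ j" "(v, w) \<in> E" using Suc by (auto dest: symD)
    then show "(v, u) \<in> E ^^ Suc j" by (rule relpow_Suc_I2[rotated])
  qed
qed (simp add: sym_Id)

lemma near_sym: "sym E \<Longrightarrow> near E k u v \<Longrightarrow> near E k v u"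
  unfolding near_def using sym_relpow symD by metis

text \<open>Such a labelling certifies lower bounds on distances, as \<open>lipschitz_relpow\<close>
  shows.\<close>

definition lipschitz :: "'a rel \<Rightarrow> ('a \<Rightarrow> nat) \<Rightarrow> bool" where
  "lipschitz E f \<longleftrightarrow> (\<forall>(u, v) \<in> E. f u \<le> Suc (f v) \<and> f v \<le> Suc (f u))"

lemma lipschitz_relpow: "lipschitz E f \<Longrightarrow> (u, v) \<in> E ^^ k \<Longrightarrow> f v \<le> f u + k"
proof (induction k arbitrary: v)
  case (Suc k)
  then obtain w where "(u, w) \<in> E ^^ k" "(w, v) \<in> E" by auto
  then show ?case using Suc.IH[of w] Suc.prems(1) by (fastforce simp: lipschitz_def)
qed simp

text \<open>The vertices in S have degree 2 and are the places where a bridge can be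
  attached.\<close>

definition subcubic :: "nat \<Rightarrow> nat rel \<Rightarrow> nat set \<Rightarrow> bool" where
  "subcubic n E S \<longleftrightarrow> E \<subseteq> {..<n} \<times> {..<n} \<and> sym E \<and> girth_ge5 E \<and>
     (\<forall>v<n. card (E `` {v}) = (if v \<in> S then 2 else 3))"

definition pentagon :: "'a rel \<Rightarrow> bool" where
  "pentagon E \<longleftrightarrow> (\<exists>a b c d e. distinct [a, b, c, d, e] \<and>
     {(a, b), (b, c), (c, d), (d, e), (e, a)} \<subseteq> E)"

lemma pentagon_image:
  assumes "pentagon E" "inj h" "\<And>x y. (x, y) \<in> E \<Longrightarrow> (h x, h y) \<in> F"
  shows "pentagon F"
proof -
  from assms(1) obtain a b c d e where "distinct [a, b, c, d, e]"
    "{(a, b), (b, c), (c, d), (d, e), (e, a)} \<subseteq> E"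
    unfolding pentagon_def by (elim exE conjE) (rule that)
  then have "distinct [h a, h b, h c, h d, h e]"
    "{(h a, h b), (h b, h c), (h c, h d), (h d, h e), (h e, h a)} \<subseteq> F"
    using assms(2,3) by (simp_all add: inj_eq)
  then show ?thesis
    unfolding pentagon_def by (intro exI conjI)
qed

definition bridge :: "nat \<Rightarrow> nat \<Rightarrow> nat rel \<Rightarrow> nat rel \<Rightarrow> nat rel" where
  "bridge n c A B = A \<union> map_prod ((+) n) ((+) n) ` B \<union> {(c, n), (n, c)}"

lemma bridge_iff:
  "(u, v) \<in> bridge n c A B \<longleftrightarrow> (u, v) \<in> A \<or> (n \<le> u \<and> n \<le> v \<and> (u - n, v - n) \<in> B) \<or>
     (u = c \<and> v = n) \<or> (u = n \<and> v = c)"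
proof -
  have "(u, v) \<in> map_prod ((+) n) ((+) n) ` B \<longleftrightarrow> n \<le> u \<and> n \<le> v \<and> (u - n, v - n) \<in> B"
    by (auto simp: image_iff map_prod_def intro!: bexI[of _ "(u - n, v - n)"])
  then show ?thesis by (auto simp: bridge_def)
qed

text \<open>A bridge lies on no cycle, so no short cycle arises; its ends c and n rise from degree 2
  to degree 3.\<close>

lemma subcubic_bridge:
  assumes A: "subcubic n A S" and B: "subcubic m B T" and c: "c < n" "c \<in> S" and 0: "0 < m" "0 \<in> T"
  shows "subcubic (n + m) (bridge n c A B) (S \<inter> {..<n} - {c} \<union> (+) n ` (T - {0}))" (is "subcubic _ ?J ?U")
proof -
  have An: "A \<subseteq> {..<n} \<times> {..<n}" "sym A" "girth_ge5 A"
    and Ad: "\<And>v. v < n \<Longrightarrow> card (A `` {v}) = (if v \<in> S then 2 else 3)"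
    using A unfolding subcubic_def by blast+
  have Bm: "B \<subseteq> {..<m} \<times> {..<m}" "sym B" "girth_ge5 B"
    and Bd: "\<And>v. v < m \<Longrightarrow> card (B `` {v}) = (if v \<in> T then 2 else 3)"
    using B unfolding subcubic_def by blast+
  have Alt: "(u, v) \<in> A \<Longrightarrow> u < n \<and> v < n" for u v using An(1) by auto
  have 1: "?J \<subseteq> {..<n + m} \<times> {..<n + m}"
    using An(1) Bm(1) c(1) 0(1) by (auto simp: bridge_def)
  have 2: "sym ?J"
    using An(2) Bm(2) by (auto simp: sym_def bridge_iff)
  have J1: "u < n \<Longrightarrow> (u, v) \<in> ?J \<longleftrightarrow> (u, v) \<in> A \<or> (u = c \<and> v = n)"
    and J2: "n \<le> u \<Longrightarrow> (u, v) \<in> ?J \<longleftrightarrow> (n \<le> v \<and> (u - n, v - n) \<in> B) \<or> (u = n \<and> v = c)" for u v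
    using c by (auto simp: bridge_iff dest: Alt)
  have triA: "(x, y) \<in> A \<Longrightarrow> (y, z) \<in> A \<Longrightarrow> (z, x) \<notin> A"
    and triB: "(x, y) \<in> B \<Longrightarrow> (y, z) \<in> B \<Longrightarrow> (z, x) \<notin> B"
    and quadA: "(x, y) \<in> A \<Longrightarrow> (y, z) \<in> A \<Longrightarrow> (z, w) \<in> A \<Longrightarrow> (w, x) \<in> A \<Longrightarrow> x = z \<or> y = w"
    and quadB: "(x, y) \<in> B \<Longrightarrow> (y, z) \<in> B \<Longrightarrow> (z, w) \<in> B \<Longrightarrow> (w, x) \<in> B \<Longrightarrow> x = z \<or> y = w"
    for x y z w
    using An(3) Bm(3) unfolding girth_ge5_def by blast+
  have cross: "(x, y) \<in> ?J \<Longrightarrow> x < n \<Longrightarrow> n \<le> y \<Longrightarrow> x = c \<and> y = n"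
    and cross': "(x, y) \<in> ?J \<Longrightarrow> n \<le> x \<Longrightarrow> y < n \<Longrightarrow> x = n \<and> y = c"
    and inA: "(x, y) \<in> ?J \<Longrightarrow> x < n \<Longrightarrow> y < n \<Longrightarrow> (x, y) \<in> A"
    and inB: "(x, y) \<in> ?J \<Longrightarrow> n \<le> x \<Longrightarrow> n \<le> y \<Longrightarrow> (x - n, y - n) \<in> B" for x y
    using J1[of x y] J2[of x y] Alt[of x y] c by auto
  have irr: "(c, c) \<notin> A" "(0, 0) \<notin> B" using triA triB by blast+
  have 3: "girth_ge5 ?J"
    unfolding girth_ge5_def
  proof (intro conjI allI impI notI)
    fix x y z assume e: "(x, y) \<in> ?J" "(y, z) \<in> ?J" "(z, x) \<in> ?J"
    consider "x < n" "y < n" "z < n" | "n \<le> x" "n \<le> y" "n \<le> z"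
      | "\<not> (x < n \<and> y < n \<and> z < n)" "\<not> (n \<le> x \<and> n \<le> y \<and> n \<le> z)" by blast
    then show False
    proof cases
      case 1
      then show ?thesis
        using triA[OF inA[OF e(1)] inA[OF e(2)]] inA[OF e(3)] by simp
    next
      case 2
      then show ?thesis
        using triB[OF inB[OF e(1)] inB[OF e(2)]] inB[OF e(3)] by simp
    next
      \<comment> \<open>A closed walk that meets both sides crosses the bridge an even number of
        times. Of three steps two cross, and the third would be a loop at c or at vertex 0 of
        B.\<close>
      case 3
      then show ?thesis
        using irr e[THEN cross] e[THEN cross'] e[THEN inA] e[THEN inB]
        by (cases "x < n"; cases "y < n"; cases "z < n") (simp_all add: not_less)
    qed
  next
    fix x y z w assume e: "(x, y) \<in> ?J" "(y, z) \<in> ?J" "(z, w) \<in> ?J" "(w, x) \<in> ?J"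
    consider "x < n" "y < n" "z < n" "w < n" | "n \<le> x" "n \<le> y" "n \<le> z" "n \<le> w"
      | "\<not> (x < n \<and> y < n \<and> z < n \<and> w < n)" "\<not> (n \<le> x \<and> n \<le> y \<and> n \<le> z \<and> n \<le> w)" by blast
    then show "x = z \<or> y = w"
    proof cases
      case 1
      then show ?thesis
        using quadA[OF inA[OF e(1)] inA[OF e(2)] inA[OF e(3)] inA[OF e(4)]] by simp
    next
      case 2
      have "x - n = z - n \<or> y - n = w - n"
        by (rule quadB[OF inB[OF e(1)] inB[OF e(2)] inB[OF e(3)] inB[OF e(4)]]) (use 2 in auto)
      then show ?thesis using 2 by linarith
    next
      \<comment> \<open>Either two opposite vertices coincide in c or n, or the walk runs c, c, n, n
        and contains a loop.\<close>
      case 3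
      then show ?thesis
        using irr e[THEN cross] e[THEN cross'] e[THEN inA]
        by (smt (verit) not_less)
    qed
  qed
  have 4: "card (?J `` {v}) = (if v \<in> ?U then 2 else 3)" if "v < n + m" for v
  proof (cases "v < n")
    case True
    have "?J `` {v} = (if v = c then insert n (A `` {v}) else A `` {v})"
      using True J1[of v] by auto
    moreover have "n \<notin> A `` {v}" using Alt by blast
    moreover have "finite (A `` {v})"
      using An(1) by (meson finite_Image finite_SigmaI finite_lessThan finite_subset)
    ultimately have "card (?J `` {v}) = (if v = c then Suc (card (A `` {v})) else card (A `` {v}))"
      by (cases "v = c") simp_all
    moreover have "v \<in> ?U \<longleftrightarrow> v \<in> S \<and> v \<noteq> c" using True by auto
    ultimately show ?thesis
      using Ad[OF True] c by (cases "v = c") simp_all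
  next
    case False
    define w where "w = v - n"
    have w: "v = n + w" "w < m" using False that by (auto simp: w_def)
    have im: "y \<in> (+) n ` (B `` {w}) \<longleftrightarrow> n \<le> y \<and> (w, y - n) \<in> B" for y
      by (auto simp: image_iff intro: bexI[of _ "y - n"])
    have "?J `` {v} = (if w = 0 then insert c ((+) n ` (B `` {w})) else (+) n ` (B `` {w}))"
    proof (rule set_eqI)
      fix y
      have "(v, y) \<in> ?J \<longleftrightarrow> n \<le> y \<and> (w, y - n) \<in> B \<or> w = 0 \<and> y = c"
        using J2[of v y] w by simp
      then show "y \<in> ?J `` {v} \<longleftrightarrow>
          y \<in> (if w = 0 then insert c ((+) n ` (B `` {w})) else (+) n ` (B `` {w}))"
        using im[of y] by (auto simp only: Image_singleton_iff insert_iff split: if_splits)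
    qed
    moreover have "c \<notin> (+) n ` (B `` {w})" using c by auto
    moreover have "finite (B `` {w})"
      using Bm(1) by (meson finite_Image finite_SigmaI finite_lessThan finite_subset)
    moreover have "card ((+) n ` (B `` {w})) = card (B `` {w})" by (simp add: card_image)
    ultimately have "card (?J `` {v}) = (if w = 0 then Suc (card (B `` {w})) else card (B `` {w}))"
      by (cases "w = 0") simp_all
    moreover have "v \<in> ?U \<longleftrightarrow> w \<in> T \<and> w \<noteq> 0" using w by auto
    ultimately show ?thesis
      using Bd[OF w(2)] 0 by (cases "w = 0") simp_all
  qed
  show ?thesis
    unfolding subcubic_def using 1 2 3 4 by blast
qed


lemma near_bridge_left: "near A k u v \<Longrightarrow> near (bridge n c A B) k u v"
  using near_image[of A id "bridge n c A B"] by (auto simp: bridge_def)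

lemma near_bridge_right: "near B k u v \<Longrightarrow> near (bridge n c A B) k (n + u) (n + v)"
  using near_image[of B "(+) n" "bridge n c A B"] by (auto simp: bridge_iff)

lemma near_bridge:
  assumes A: "\<And>u v. u < n \<Longrightarrow> v < n \<Longrightarrow> near A a u v"
    and B: "\<And>u v. u < m \<Longrightarrow> v < m \<Longrightarrow> near B b u v"
    and sym: "sym A" "sym B" and c: "c < n" and uv: "u < n + m" "v < n + m"
  shows "near (bridge n c A B) (a + b + 1) u v"
proof -
  let ?J = "bridge n c A B"
  have symJ: "sym ?J" using sym by (auto simp: sym_def bridge_iff)
  have cross: "near ?J (a + b + 1) x (n + y)" if "x < n" "y < m" for x y
  proof -
    have "near ?J a x c" using A that c near_bridge_left by blast
    moreover have "near ?J 1 c n" by (rule near_edge) (simp add: bridge_def)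
    moreover have "near ?J b n (n + y)"
      using near_bridge_right[OF B[of 0 y]] that by simp
    ultimately have "near ?J (a + 1 + b) x (n + y)" by (blast intro: near_trans)
    then show ?thesis by (simp add: ac_simps)
  qed
  consider "u < n" "v < n" | y where "u < n" "v = n + y" "y < m" | x where "u = n + x" "x < m" "v < n"
    | x y where "u = n + x" "v = n + y" "x < m" "y < m"
    using uv by (metis add_less_cancel_left le_Suc_ex not_less)
  then show ?thesis
  proof cases
    case 1
    then show ?thesis using near_mono[OF near_bridge_left[OF A]] by simp
  next
    case 2
    then show ?thesis using cross by simp
  next
    case 3
    then show ?thesis using cross near_sym[OF symJ] by simp
  next
    case 4
    then show ?thesis using near_mono[OF near_bridge_right[OF B]] by simp
  qed
qed

text \<open>The labels of B continue those of A: the far end n of the bridge gets one more than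
  c.\<close>

lemma lipschitz_bridge:
  assumes "A \<subseteq> {..<n} \<times> {..<n}" "c < n" "lipschitz A f" "lipschitz B g" "f c = k" "g 0 = 0"
  shows "lipschitz (bridge n c A B) (\<lambda>x. if x < n then f x else k + 1 + g (x - n))"
  using assms unfolding lipschitz_def by (fastforce simp: bridge_iff)

section \<open>Pieces and their diameters\<close>

text \<open>The diameter e is attained from the attachment vertex 0, so that diameters add up when
  pieces are joined.\<close>

definition pendant :: "nat \<Rightarrow> nat \<Rightarrow> nat rel \<Rightarrow> bool" where
  "pendant n e E \<longleftrightarrow> subcubic n E {0} \<and> 0 < n \<and> pentagon E \<and>
     (\<forall>u<n. \<forall>v<n. near E e u v) \<and> (\<exists>f. lipschitz E f \<and> f 0 = 0 \<and> (\<exists>v<n. f v = e))"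

definition cubic_graph :: "nat \<Rightarrow> nat \<Rightarrow> nat rel \<Rightarrow> bool" where
  "cubic_graph n d E \<longleftrightarrow> subcubic n E {} \<and> pentagon E \<and>
     (\<forall>u<n. \<forall>v<n. near E d u v) \<and> (\<exists>f. lipschitz E f \<and> (\<exists>u<n. \<exists>v<n. f u = 0 \<and> f v = d))"

text \<open>A longest path runs from a farthest vertex of A over the bridge to a farthest vertex of
  B.\<close>

lemma cubic_graph_bridge:
  assumes A: "pendant n a A" and B: "pendant m b B"
  shows "cubic_graph (n + m) (a + b + 1) (bridge n 0 A B)"
proof -
  obtain f p where f: "lipschitz A f" "f 0 = 0" "p < n" "f p = a"
    using A unfolding pendant_def by blast
  obtain g q where g: "lipschitz B g" "g 0 = 0" "q < m" "g q = b"
    using B unfolding pendant_def by blast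
  have A': "subcubic n A {0}" "0 < n" "pentagon A" "\<And>u v. u < n \<Longrightarrow> v < n \<Longrightarrow> near A a u v"
    and B': "subcubic m B {0}" "0 < m" "\<And>u v. u < m \<Longrightarrow> v < m \<Longrightarrow> near B b u v"
    using A B unfolding pendant_def by blast+
  have An: "A \<subseteq> {..<n} \<times> {..<n}" "sym A" "sym B"
    using A'(1) B'(1) unfolding subcubic_def by blast+
  \<comment> \<open>Reversed, the labels are 0 at the far vertex p and a at the bridge end 0.
    Truncated subtraction keeps them Lipschitz.\<close>
  have "lipschitz A (\<lambda>x. a - f x)"
    using f(1) unfolding lipschitz_def by fastforce
  then have "lipschitz (bridge n 0 A B) (\<lambda>x. if x < n then a - f x else a + 1 + g (x - n))"
    by (rule lipschitz_bridge[OF An(1) A'(2) _ g(1)]) (use f g in auto)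
  moreover have "p < n + m" "n + q < n + m" using f g by auto
  ultimately have "\<exists>h. lipschitz (bridge n 0 A B) h \<and> (\<exists>u<n+m. \<exists>v<n+m. h u = 0 \<and> h v = a + b + 1)"
    using f g by (intro exI[of _ "\<lambda>x. if x < n then a - f x else a + 1 + g (x - n)"] conjI exI[of _ p] exI[of _ "n + q"]) auto
  moreover have "{0} \<inter> {..<n} - {0} \<union> (+) n ` ({0} - {0}) = {}" by auto
  then have "subcubic (n + m) (bridge n 0 A B) {}"
    using subcubic_bridge[OF A'(1) B'(1) A'(2) _ B'(2)] by (metis singletonI)
  moreover have "pentagon (bridge n 0 A B)"
    using A'(3) by (rule pentagon_image[of _ id]) (auto simp: bridge_def)
  ultimately show ?thesis
    unfolding cubic_graph_def using near_bridge[OF A'(4) B'(3) An(2,3) A'(2)] by blast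
qed

text \<open>The vertex c of A receives the bridge, and 0 stays free for the next one. The distance
  from 0 to c is the full diameter bound a of A.\<close>

lemma pendant_bridge:
  assumes A: "subcubic n A {0, c}" "c < n" "0 < n" "c \<noteq> 0" "\<And>u v. u < n \<Longrightarrow> v < n \<Longrightarrow> near A a u v"
    "lipschitz A f" "f 0 = 0" "f c = a"
    and B: "pendant m b B"
  shows "pendant (n + m) (a + b + 1) (bridge n c A B)"
proof -
  obtain g q where g: "lipschitz B g" "g 0 = 0" "q < m" "g q = b"
    using B unfolding pendant_def by blast
  have B': "subcubic m B {0}" "0 < m" "pentagon B" "\<And>u v. u < m \<Longrightarrow> v < m \<Longrightarrow> near B b u v"
    using B unfolding pendant_def by blast+
  have An: "A \<subseteq> {..<n} \<times> {..<n}" "sym A" "sym B"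
    using A(1) B'(1) unfolding subcubic_def by blast+
  have "lipschitz (bridge n c A B) (\<lambda>x. if x < n then f x else a + 1 + g (x - n))"
    by (rule lipschitz_bridge) (use An A g in auto)
  then have "\<exists>h. lipschitz (bridge n c A B) h \<and> h 0 = 0 \<and> (\<exists>v<n+m. h v = a + b + 1)"
    using A g by (intro exI[of _ "\<lambda>x. if x < n then f x else a + 1 + g (x - n)"] conjI exI[of _ "n + q"]) auto
  moreover have "{0, c} \<inter> {..<n} - {c} \<union> (+) n ` ({0} - {0}) = {0}"
    using A by auto
  then have "subcubic (n + m) (bridge n c A B) {0}"
    using subcubic_bridge[OF A(1) B'(1) A(2) _ B'(2)] by (metis insertCI)
  moreover have "pentagon (bridge n c A B)"
    using B'(3) by (rule pentagon_image[of _ "(+) n"]) (auto simp: bridge_iff inj_def)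
  ultimately show ?thesis
    unfolding pendant_def using near_bridge[OF A(5) B'(4) An(2,3) A(2)] A(3) by simp
qed

section \<open>Graphs given by adjacency lists\<close>

definition adjacency_rel :: "nat list list \<Rightarrow> nat rel" where
  "adjacency_rel xs = {(u, v). u < length xs \<and> v \<in> set (xs ! u)}"

text \<open>
  The girth is at least 5 iff the tree of walks of length at most 2 without backtracking from any
  vertex has no repeated vertex.
\<close>
definition subcubic_list :: "nat list list \<Rightarrow> nat list \<Rightarrow> bool" where
  "subcubic_list xs S \<longleftrightarrow> (\<forall>u\<in>set [0..<length xs].
      length (xs ! u) = (if u \<in> set S then 2 else 3) \<and>
      (\<forall>v\<in>set (xs ! u). v < length xs \<and> u \<in> set (xs ! v)) \<and>
      distinct (u # xs ! u @ concat (map (\<lambda>v. removeAll u (xs ! v)) (xs ! u))))"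

lemma distinct_concat_map_eq:
  "distinct (concat (map h ys)) \<Longrightarrow> b \<in> set ys \<Longrightarrow> d \<in> set ys \<Longrightarrow> c \<in> set (h b) \<Longrightarrow> c \<in> set (h d) \<Longrightarrow> b = d"
  by (induction ys) auto

text \<open>In the tree of walks from a, a triangle a, b, c shows c at depths 1 and 2, and a 4-cycle
  a, b, c, d shows c below b and below d.\<close>

lemma subcubic_adjacency_rel:
  assumes "subcubic_list xs S"
  shows "subcubic (length xs) (adjacency_rel xs) (set S)"
proof -
  let ?E = "adjacency_rel xs"
  have main: "length (xs ! u) = (if u \<in> set S then 2 else 3) \<and>
      (\<forall>v\<in>set (xs ! u). v < length xs \<and> u \<in> set (xs ! v)) \<and>
      distinct (u # xs ! u @ concat (map (\<lambda>v. removeAll u (xs ! v)) (xs ! u)))"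
    if "u < length xs" for u
    using assms[unfolded subcubic_list_def] by (rule bspec) (use that in simp)
  note deg = main[THEN conjunct1]
  note sym = main[THEN conjunct2, THEN conjunct1, THEN bspec]
  have dist: "u \<notin> set (xs ! u)" "distinct (xs ! u)"
    "set (xs ! u) \<inter> set (concat (map (\<lambda>v. removeAll u (xs ! v)) (xs ! u))) = {}"
    "distinct (concat (map (\<lambda>v. removeAll u (xs ! v)) (xs ! u)))" if "u < length xs" for u
    using main[OF that, THEN conjunct2, THEN conjunct2]
    unfolding distinct.simps distinct_append by auto
  have im: "?E `` {u} = set (xs ! u)" if "u < length xs" for u
    using that by (auto simp: adjacency_rel_def)
  have E: "(u, v) \<in> ?E \<longleftrightarrow> u < length xs \<and> v \<in> set (xs ! u)" for u v
    by (simp add: adjacency_rel_def)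
  have irr: "(u, u) \<notin> ?E" for u
    using dist(1)[of u] by (auto simp: E)
  have symE: "(u, v) \<in> ?E \<Longrightarrow> (v, u) \<in> ?E" for u v
    using sym[of u v] by (simp add: E)
  have "girth_ge5 ?E"
    unfolding girth_ge5_def
  proof (intro conjI allI impI notI)
    fix a b c assume e: "(a, b) \<in> ?E" "(b, c) \<in> ?E" "(c, a) \<in> ?E"
    then have a: "a < length xs" "c \<noteq> a" "c \<in> set (xs ! a)" using irr symE[of c a] by (auto simp: E)
    moreover have "c \<in> set (concat (map (\<lambda>v. removeAll a (xs ! v)) (xs ! a)))"
      using e a by (auto simp: E)
    ultimately show False using dist(3)[of a] by blast
  next
    fix a b c d assume e: "(a, b) \<in> ?E" "(b, c) \<in> ?E" "(c, d) \<in> ?E" "(d, a) \<in> ?E"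
    show "a = c \<or> b = d"
    proof (rule ccontr)
      assume "\<not> (a = c \<or> b = d)"
      then have "c \<in> set (removeAll a (xs ! b))" "c \<in> set (removeAll a (xs ! d))"
        "b \<in> set (xs ! a)" "d \<in> set (xs ! a)" "b \<noteq> d"
        using e symE[of c d] symE[of d a] by (auto simp: E)
      moreover have "distinct (concat (map (\<lambda>v. removeAll a (xs ! v)) (xs ! a)))"
        using dist(4)[of a] e by (simp add: E)
      ultimately show False
        using distinct_concat_map_eq[of "\<lambda>v. removeAll a (xs ! v)" "xs ! a" b d c] by blast
    qed
  qed
  moreover have "card (?E `` {u}) = (if u \<in> set S then 2 else 3)" if "u < length xs" for u
    using deg[OF that] dist(2)[OF that] by (simp add: im[OF that] distinct_card)
  moreover have "?E \<subseteq> {..<length xs} \<times> {..<length xs}"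
  proof (rule subrelI)
    fix u v assume "(u, v) \<in> ?E"
    then show "(u, v) \<in> {..<length xs} \<times> {..<length xs}"
      using symE[of u v] E[of u v] E[of v u] by simp
  qed
  moreover have "sym ?E"
    by (rule symI) (rule symE)
  ultimately show ?thesis
    unfolding subcubic_def by blast
qed

section \<open>Distances by breadth-first search\<close>

definition unvisited_nbrs :: "nat list list \<Rightarrow> nat list \<Rightarrow> nat list \<Rightarrow> nat list" where
  "unvisited_nbrs xs vis fr = remdups (filter (\<lambda>v. v \<notin> set vis) (concat (map ((!) xs) fr)))"

text \<open>The search runs for a fixed number of rounds; \<open>vis\<close> holds all vertices
  found so far, \<open>fr\<close> those of the last round.\<close>

fun bfs :: "nat list list \<Rightarrow> nat \<Rightarrow> nat list \<Rightarrow> nat list \<Rightarrow> nat list" where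
  "bfs xs 0 vis fr = vis"
| "bfs xs (Suc k) vis fr = bfs xs k (vis @ unvisited_nbrs xs vis fr) (unvisited_nbrs xs vis fr)"

text \<open>Each round adds one edge. Soundness suffices, since the search only serves for upper
  bounds on distances.\<close>

lemma bfs_near:
  assumes "\<And>v. v \<in> set fr \<union> set vis \<Longrightarrow> v < length xs \<and> near (adjacency_rel xs) j u v"
    and "\<And>v w. (v, w) \<in> adjacency_rel xs \<Longrightarrow> w < length xs"
    and "v \<in> set (bfs xs k vis fr)"
  shows "near (adjacency_rel xs) (j + k) u v"
  using assms(1,3)
proof (induction k arbitrary: j vis fr)
  case 0
  then show ?case by simp
next
  case (Suc k)
  define new where "new = unvisited_nbrs xs vis fr"
  have "near (adjacency_rel xs) (Suc j + k) u v"
  proof (rule Suc.IH)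
    show "v \<in> set (bfs xs k (vis @ new) new)"
      using Suc.prems(2) by (simp add: new_def)
    fix w assume "w \<in> set new \<union> set (vis @ new)"
    then consider "w \<in> set vis" | x where "x \<in> set fr" "(x, w) \<in> adjacency_rel xs"
      using Suc.prems(1) by (auto simp: new_def unvisited_nbrs_def adjacency_rel_def)
    then show "w < length xs \<and> near (adjacency_rel xs) (Suc j) u w"
    proof cases
      case 1
      then show ?thesis using Suc.prems(1) near_mono[of _ j u w "Suc j"] by auto
    next
      case 2
      then show ?thesis
        using near_trans[OF _ near_edge[OF 2(2)], of j u] Suc.prems(1)[of x] assms(2) by auto
    qed
  qed
  then show ?case by simp
qed

definition covers :: "nat list list \<Rightarrow> nat \<Rightarrow> nat \<Rightarrow> bool" where
  "covers xs e u \<longleftrightarrow> set [0..<length xs] \<subseteq> set (bfs xs e [u] [u])"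

text \<open>
  With a partial application under \<open>list_all\<close> the simplifier does not evaluate the search
  for a symbolic starting vertex, which would take exponential time.
\<close>
definition near_list :: "nat list list \<Rightarrow> nat \<Rightarrow> bool" where
  "near_list xs e \<longleftrightarrow> list_all (covers xs e) [0..<length xs]"

lemma near_adjacency_rel:
  assumes "subcubic_list xs S" "near_list xs e" "u < length xs" "v < length xs"
  shows "near (adjacency_rel xs) e u v"
proof -
  have "w < length xs" if "(x, w) \<in> adjacency_rel xs" for x w
    using subcubic_adjacency_rel[OF assms(1)] that unfolding subcubic_def by blast
  moreover have "v \<in> set (bfs xs e [u] [u])"
    using assms(2-4) unfolding near_list_def covers_def list_all_iff by (auto dest!: bspec[of _ _ u])
  ultimately show ?thesis
    using bfs_near[of "[u]" "[u]" xs 0 u v e] assms(3) by simp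
qed

definition lipschitz_list :: "nat list list \<Rightarrow> nat list \<Rightarrow> bool" where
  "lipschitz_list xs fs \<longleftrightarrow> (\<forall>u\<in>set [0..<length xs]. \<forall>v\<in>set (xs ! u).
     fs ! u \<le> Suc (fs ! v) \<and> fs ! v \<le> Suc (fs ! u))"

lemma lipschitz_adjacency_rel: "lipschitz_list xs fs \<Longrightarrow> lipschitz (adjacency_rel xs) ((!) fs)"
  by (auto simp: lipschitz_list_def lipschitz_def adjacency_rel_def)

fun pentagon_list :: "nat list list \<Rightarrow> nat list \<Rightarrow> bool" where
  "pentagon_list xs [a, b, c, d, e] \<longleftrightarrow> distinct [a, b, c, d, e] \<and>
     (\<forall>v\<in>set [a, b, c, d, e]. v < length xs) \<and> b \<in> set (xs ! a) \<and> c \<in> set (xs ! b) \<and>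
     d \<in> set (xs ! c) \<and> e \<in> set (xs ! d) \<and> a \<in> set (xs ! e)"
| "pentagon_list xs _ = False"

lemma pentagon_adjacency_rel:
  assumes "pentagon_list xs ps"
  shows "pentagon (adjacency_rel xs)"
  using assms
proof (cases rule: pentagon_list.cases[of "(xs, ps)"])
  case (1 ys a b c d e)
  then have "distinct [a, b, c, d, e]"
    "{(a, b), (b, c), (c, d), (d, e), (e, a)} \<subseteq> adjacency_rel xs"
    using assms by (simp_all add: adjacency_rel_def)
  then show ?thesis
    unfolding pentagon_def by (intro exI conjI)
qed auto

text \<open>
  The list \<open>fs\<close> bounds the distances from vertex 0 from below. In the graphs that follow the vertices
  are numbered in breadth-first order, so that the last one is farthest from 0.
\<close>
definition certified :: "nat list list \<Rightarrow> nat list \<Rightarrow> nat \<Rightarrow> nat list \<Rightarrow> nat list \<Rightarrow> bool" where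
  "certified xs S e fs ps \<longleftrightarrow> subcubic_list xs S \<and> near_list xs e \<and> lipschitz_list xs fs \<and>
     pentagon_list xs ps \<and> fs ! 0 = 0 \<and> fs ! (length xs - 1) = e \<and> 0 < length xs"

lemma certifiedD:
  assumes "certified xs S e fs ps"
  shows "subcubic (length xs) (adjacency_rel xs) (set S)" "0 < length xs"
    "pentagon (adjacency_rel xs)"
    "u < length xs \<Longrightarrow> v < length xs \<Longrightarrow> near (adjacency_rel xs) e u v"
    "lipschitz (adjacency_rel xs) ((!) fs)" "fs ! 0 = 0" "fs ! (length xs - 1) = e"
proof -
  have c: "subcubic_list xs S" "near_list xs e" "lipschitz_list xs fs" "pentagon_list xs ps"
    "0 < length xs" "fs ! 0 = 0" "fs ! (length xs - 1) = e"
    using assms unfolding certified_def by simp_all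
  show "subcubic (length xs) (adjacency_rel xs) (set S)"
    using c(1) by (rule subcubic_adjacency_rel)
  show "near (adjacency_rel xs) e u v" if "u < length xs" "v < length xs"
    using c(1,2) that by (rule near_adjacency_rel)
  show "lipschitz (adjacency_rel xs) ((!) fs)"
    using c(3) by (rule lipschitz_adjacency_rel)
  show "pentagon (adjacency_rel xs)"
    using c(4) by (rule pentagon_adjacency_rel)
qed (use assms in \<open>simp_all add: certified_def\<close>)

lemma pendant_adjacency_rel:
  assumes "certified xs [0] e fs ps"
  shows "pendant (length xs) e (adjacency_rel xs)"
  unfolding pendant_def
proof (intro conjI allI impI exI)
  show "length xs - 1 < length xs"
    using certifiedD(2)[OF assms] by simp
  show "subcubic (length xs) (adjacency_rel xs) {0}"
    using certifiedD(1)[OF assms] by simp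
qed (rule certifiedD[OF assms]; assumption)+

lemma cubic_graph_adjacency_rel:
  assumes "certified xs [] e fs ps"
  shows "cubic_graph (length xs) e (adjacency_rel xs)"
  unfolding cubic_graph_def
proof (intro conjI allI impI exI)
  show "length xs - 1 < length xs" "0 < length xs" "fs ! 0 = 0" "fs ! (length xs - 1) = e"
    using certifiedD(2,6,7)[OF assms] by simp_all
  show "subcubic (length xs) (adjacency_rel xs) {}"
    using certifiedD(1)[OF assms] by simp
qed (rule certifiedD[OF assms]; assumption)+

text \<open>The last vertex of the list is at once farthest from 0 and the second attachment
  vertex.\<close>

lemma pendant_prepend_block:
  assumes "certified xs [0, length xs - 1] a fs ps" "1 < length xs" "pendant m b B"
  shows "pendant (length xs + m) (a + b + 1) (bridge (length xs) (length xs - 1) (adjacency_rel xs) B)"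
proof (rule pendant_bridge[where f = "(!) fs"])
  show "subcubic (length xs) (adjacency_rel xs) {0, length xs - 1}"
    using certifiedD(1)[OF assms(1)] by simp
qed (use assms(2,3) certifiedD[OF assms(1)] in auto)

text \<open>The missing edge joins 0 and 9, whose distance becomes 4.\<close>
definition petersen_minus_edge :: "nat list list" where
  "petersen_minus_edge =
    [[1, 2], [0, 3, 4], [0, 5, 6], [1, 5, 7], [1, 6, 8], [2, 3, 8], [2, 4, 7], [3, 6, 9],
    [4, 5, 9], [7, 8]]"

lemma certified_petersen_minus_edge:
  "certified petersen_minus_edge [0, 9] 4
    [0, 1, 1, 2, 2, 2, 2, 3, 3, 4] [0, 1, 3, 5, 2]"
  by code_simp

section \<open>Pieces with one vertex of degree 2\<close>

text \<open>The Petersen graph with one edge subdivided by 0.\<close>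

definition end11 :: "nat list list" where
  "end11 =
    [[1, 2], [0, 3, 4], [0, 5, 6], [1, 7, 8], [1, 9, 10], [2, 7, 10], [2, 8, 9], [3, 5, 9],
    [3, 6, 10], [4, 6, 7], [4, 5, 8]]"

lemma certified_end11:
  "certified end11 [0] 3
    [0, 1, 1, 2, 2, 2, 2, 3, 3, 3, 3] [1, 3, 7, 9, 4]"
  by code_simp

definition end13 :: "nat list list" where
  "end13 =
    [[1, 2], [0, 3, 4], [0, 5, 6], [1, 7, 8], [1, 6, 9], [2, 8, 10], [2, 4, 11], [3, 9, 10],
    [3, 5, 12], [4, 7, 12], [5, 7, 11], [6, 10, 12], [8, 9, 11]]"

lemma certified_end13:
  "certified end13 [0] 4
    [0, 1, 1, 2, 2, 2, 2, 3, 3, 3, 3, 3, 4] [0, 1, 4, 6, 2]"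
  by code_simp

text \<open>The Petersen graph minus a vertex, on 0 to 8, joined by two edges to the Petersen graph
  minus an edge, on 9 to 18. The third neighbour of the deleted vertex is 0.\<close>

definition end19 :: "nat list list" where
  "end19 =
    [[1, 2], [0, 3, 4], [0, 5, 6], [1, 5, 7], [1, 6, 8], [2, 3, 8], [2, 4, 7], [3, 6, 9],
    [4, 5, 10], [7, 11, 12], [8, 13, 14], [9, 15, 16], [9, 17, 18], [10, 15, 18], [10, 16,
    17], [11, 13, 17], [11, 14, 18], [12, 14, 15], [12, 13, 16]]"

lemma certified_end19:
  "certified end19 [0] 6
    [0, 1, 1, 2, 2, 2, 2, 3, 3, 4, 4, 5, 5, 5, 5, 6, 6, 6, 6] [0, 1, 3, 5, 2]"
  by code_simp

text \<open>As \<open>end19\<close>, but the two joining edges are subdivided by 9 and 10, and these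
  are joined by an edge.\<close>

definition end21 :: "nat list list" where
  "end21 =
    [[1, 2], [0, 3, 4], [0, 5, 6], [1, 5, 7], [1, 6, 8], [2, 3, 8], [2, 4, 7], [3, 6, 9],
    [4, 5, 10], [7, 10, 11], [8, 9, 12], [9, 13, 14], [10, 15, 16], [11, 17, 18], [11, 19,
    20], [12, 17, 20], [12, 18, 19], [13, 15, 19], [13, 16, 20], [14, 16, 17], [14, 15, 18]]"

lemma certified_end21:
  "certified end21 [0] 7
    [0, 1, 1, 2, 2, 2, 2, 3, 3, 4, 4, 5, 5, 6, 6, 6, 6, 7, 7, 7, 7] [0, 1, 3, 5, 2]"
  by code_simp

section \<open>Cubic graphs of diameter 2 to 6\<close>

definition petersen :: "nat list list" where
  "petersen =
    [[1, 2, 3], [0, 4, 5], [0, 6, 7], [0, 8, 9], [1, 6, 8], [1, 7, 9], [2, 4, 9], [2, 5, 8],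
    [3, 4, 7], [3, 5, 6]]"

lemma certified_petersen:
  "certified petersen [] 2
    [0, 1, 1, 1, 2, 2, 2, 2, 2, 2] [0, 1, 4, 6, 2]"
  by code_simp

definition graph12 :: "nat list list" where
  "graph12 =
    [[1, 2, 3], [0, 4, 5], [0, 6, 7], [0, 8, 9], [1, 8, 10], [1, 9, 11], [2, 9, 10], [2, 8,
    11], [3, 4, 7], [3, 5, 6], [4, 6, 11], [5, 7, 10]]"

lemma certified_graph12:
  "certified graph12 [] 3
    [0, 1, 1, 1, 2, 2, 2, 2, 2, 2, 3, 3] [0, 1, 4, 8, 3]"
  by code_simp

definition graph14 :: "nat list list" where
  "graph14 =
    [[1, 2, 3], [0, 4, 5], [0, 6, 7], [0, 8, 9], [1, 7, 10], [1, 9, 11], [2, 8, 11], [2, 4,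
    12], [3, 6, 12], [3, 5, 10], [4, 9, 13], [5, 6, 13], [7, 8, 13], [10, 11, 12]]"

lemma certified_graph14:
  "certified graph14 [] 4
    [0, 1, 1, 1, 2, 2, 2, 2, 2, 2, 3, 3, 3, 4] [0, 1, 4, 7, 2]"
  by code_simp

text \<open>Two copies of the Petersen graph minus an edge, joined by the edges 0-3 and
  16-19.\<close>

definition graph20 :: "nat list list" where
  "graph20 =
    [[1, 2, 3], [0, 4, 5], [0, 6, 7], [0, 8, 9], [1, 6, 10], [1, 7, 11], [2, 4, 11], [2, 5,
    10], [3, 12, 13], [3, 14, 15], [4, 7, 16], [5, 6, 16], [8, 14, 17], [8, 15, 18], [9, 12,
    18], [9, 13, 17], [10, 11, 19], [12, 15, 19], [13, 14, 19], [16, 17, 18]]"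

lemma certified_graph20:
  "certified graph20 [] 5
    [0, 1, 1, 1, 2, 2, 2, 2, 2, 2, 3, 3, 3, 3, 3, 3, 4, 4, 4, 5] [0, 1, 4, 6, 2]"
  by code_simp

text \<open>Two copies of the Petersen graph minus an edge, joined by two paths whose inner vertices
  10 and 11 are adjacent.\<close>

definition graph22 :: "nat list list" where
  "graph22 =
    [[1, 2, 3], [0, 4, 5], [0, 6, 7], [0, 8, 9], [1, 6, 10], [1, 7, 8], [2, 4, 8], [2, 5,
    9], [3, 5, 6], [3, 7, 11], [4, 11, 12], [9, 10, 13], [10, 14, 15], [11, 16, 17], [12,
    18, 19], [12, 20, 21], [13, 18, 21], [13, 19, 20], [14, 16, 20], [14, 17, 21], [15, 17,
    18], [15, 16, 19]]"

lemma certified_graph22: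
  "certified graph22 [] 6
    [0, 1, 1, 1, 2, 2, 2, 2, 2, 2, 3, 3, 4, 4, 5, 5, 5, 5, 6, 6, 6, 6] [0, 1, 4, 6, 2]"
  by code_simp

section \<open>Walks, girth and diameter\<close>

text \<open>The hypothesis concerns the empty walk: it exists only at a vertex, whereas the power 0
  is the identity on the whole type.\<close>

lemma (in pair_wf_digraph) awalk_relpow:
  assumes "u \<in> pverts G"
  shows "(u, v) \<in> parcs G ^^ k \<longleftrightarrow> (\<exists>p. awalk u p v \<and> length p = k)"
  using assms
proof (induction k arbitrary: u)
  case 0
  then show ?case by (auto simp: awalk_Nil_iff)
next
  case (Suc k)
  show ?case
  proof
    assume "(u, v) \<in> parcs G ^^ Suc k"
    then obtain w where w: "(u, w) \<in> parcs G" "(w, v) \<in> parcs G ^^ k"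
      by (meson relpow_Suc_D2)
    then obtain p where "awalk w p v" "length p = k"
      using Suc.IH[of w] in_arcsD2 by blast
    then have "awalk u ((u, w) # p) v \<and> length ((u, w) # p) = Suc k"
      using w(1) Suc.prems by (simp add: awalk_Cons_iff)
    then show "\<exists>p. awalk u p v \<and> length p = Suc k" by blast
  next
    assume "\<exists>p. awalk u p v \<and> length p = Suc k"
    then obtain e p where p: "awalk u (e # p) v" "length p = k"
      by (metis length_Suc_conv)
    then have "e \<in> parcs G" "fst e = u" "awalk (snd e) p v"
      by (auto simp: awalk_Cons_iff)
    moreover have "(snd e, v) \<in> parcs G ^^ k"
      using Suc.IH[of "snd e"] calculation p(2) arc_snd_in_verts by blast
    ultimately show "(u, v) \<in> parcs G ^^ Suc k"
      by (metis prod.collapse relpow_Suc_I2)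
  qed
qed

lemma (in pair_wf_digraph) gdist_le_iff:
  assumes "u \<in> pverts G"
  shows "gdist u v \<le> enat k \<longleftrightarrow> near (parcs G) k u v"
proof
  assume le: "gdist u v \<le> enat k"
  \<comment> \<open>A strict bound on the infimum yields an actual walk.\<close>
  then have "(INF p \<in> {p. awalk u p v}. enat (length p)) < enat (Suc k)"
    unfolding gdist_def by (simp add: le_less_trans)
  then obtain p where "awalk u p v" "length p < Suc k"
    by (auto simp: INF_less_iff)
  then show "near (parcs G) k u v"
    unfolding near_def awalk_relpow[OF assms] by (auto simp: less_Suc_eq_le)
next
  assume "near (parcs G) k u v"
  then obtain p where "awalk u p v" "length p \<le> k"
    unfolding near_def awalk_relpow[OF assms] by auto
  then show "gdist u v \<le> enat k"
    unfolding gdist_def by (meson INF_lower2 enat_ord_simps(1) mem_Collect_eq)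
qed

lemma (in pair_wf_digraph) out_degree_card: "out_degree G v = card (parcs G `` {v})"
proof -
  have "out_arcs G v = Pair v ` (parcs G `` {v})"
    by (auto simp: out_arcs_def)
  then show ?thesis
    by (simp add: out_degree_def card_image inj_on_def)
qed

text \<open>As there are no loops, a violation of either condition is a cycle of length 3 or 4,
  shorter than the girth.\<close>

lemma (in pair_graph) girth_ge5_parcs:
  assumes "girth = enat 5"
  shows "girth_ge5 (parcs G)"
proof -
  have g: "5 \<le> length p" if "cycle p" "3 \<le> length p" for p
  proof -
    have "girth \<le> enat (length p)"
      unfolding girth_def by (rule INF_lower) (use that in auto)
    then show ?thesis using assms by simp
  qed
  have V: "(a, b) \<in> parcs G \<Longrightarrow> a \<in> pverts G" for a b
    by (rule in_arcsD1)
  show ?thesis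
    unfolding girth_ge5_def
  proof (intro conjI allI impI notI)
    fix a b c assume e: "(a, b) \<in> parcs G" "(b, c) \<in> parcs G" "(c, a) \<in> parcs G"
    then have "cycle [(a, b), (b, c), (c, a)]"
      unfolding cycle_def using V no_loops'
      by (intro exI[of _ a]) (auto simp: awalk_def)
    then show False using g by fastforce
  next
    fix a b c d assume e: "(a, b) \<in> parcs G" "(b, c) \<in> parcs G" "(c, d) \<in> parcs G" "(d, a) \<in> parcs G"
    show "a = c \<or> b = d"
    proof (rule ccontr)
      assume "\<not> (a = c \<or> b = d)"
      then have "cycle [(a, b), (b, c), (c, d), (d, a)]"
        unfolding cycle_def using e V no_loops'
        by (intro exI[of _ a]) (auto simp: awalk_def)
      then show False using g by fastforce
    qed
  qed
qed

text \<open>The pentagon bounds the girth from above; the arcs of a cycle of length 3 or 4 would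
  violate \<open>girth_ge5\<close>.\<close>

lemma (in pair_graph) girth_eq_5:
  assumes "girth_ge5 (parcs G)" "pentagon (parcs G)"
  shows "girth = enat 5"
proof (rule antisym)
  from assms(2) obtain a b c d e where *: "distinct [a, b, c, d, e]"
    "{(a, b), (b, c), (c, d), (d, e), (e, a)} \<subseteq> parcs G"
    unfolding pentagon_def by (elim exE conjE) (rule that)
  then have "cycle [(a, b), (b, c), (c, d), (d, e), (e, a)]"
    unfolding cycle_def using in_arcsD1 by (intro exI[of _ a]) (auto simp: awalk_def)
  then have "girth \<le> enat (length [(a, b), (b, c), (c, d), (d, e), (e, a)])"
    unfolding girth_def by (intro INF_lower) simp
  then show "girth \<le> enat 5" by (simp add: numeral_eq_Suc)
  show "enat 5 \<le> girth"
    unfolding girth_def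
  proof (rule INF_greatest)
    fix p assume "p \<in> {p. cycle p \<and> 3 \<le> length p}"
    then obtain u where p: "awalk u p u" "distinct (tl (awalk_verts u p))" "3 \<le> length p"
      unfolding cycle_def by auto
    have "length p \<noteq> 3"
    proof
      assume "length p = 3"
      then obtain x y z where xyz: "p = [x, y, z]"
        by (auto simp: numeral_eq_Suc length_Suc_conv)
      obtain a b c where "p = [(a, b), (b, c), (c, a)]"
        using p(1) unfolding awalk_def xyz by (cases x; cases y; cases z) auto
      then have "(a, b) \<in> parcs G" "(b, c) \<in> parcs G" "(c, a) \<in> parcs G"
        using p(1) unfolding awalk_def by auto
      then show False
        using assms(1) unfolding girth_ge5_def by blast
    qed
    moreover have "length p \<noteq> 4"
    proof
      assume "length p = 4"
      then obtain x y z w where xyzw: "p = [x, y, z, w]"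
        by (auto simp: numeral_eq_Suc length_Suc_conv)
      obtain a b c d where "p = [(a, b), (b, c), (c, d), (d, a)]"
        using p(1) unfolding awalk_def xyzw by (cases x; cases y; cases z; cases w) auto
      then have "(a, b) \<in> parcs G" "(b, c) \<in> parcs G" "(c, d) \<in> parcs G" "(d, a) \<in> parcs G"
        "a \<noteq> c" "b \<noteq> d"
        using p(1,2) unfolding awalk_def by auto
      then show False
        using assms(1) unfolding girth_ge5_def by blast
    qed
    ultimately show "enat 5 \<le> enat (length p)"
      using p(3) by simp
  qed
qed


lemma (in pair_graph) diameter_le_iff:
  "diameter \<le> enat d \<longleftrightarrow> (\<forall>u \<in> pverts G. \<forall>v \<in> pverts G. near (parcs G) d u v)"
  unfolding diameter_def by (auto simp: SUP_le_iff gdist_le_iff)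

lemma min_order_le:
  assumes "cubic_graph n d E"
  shows "min_order 3 5 d \<le> enat n"
proof -
  let ?G = "\<lparr>pverts = {..<n}, parcs = E\<rparr>"
  have E: "E \<subseteq> {..<n} \<times> {..<n}" "sym E" "girth_ge5 E" "\<And>v. v < n \<Longrightarrow> card (E `` {v}) = 3"
    "pentagon E" "\<And>u v. u < n \<Longrightarrow> v < n \<Longrightarrow> near E d u v"
    using assms unfolding cubic_graph_def subcubic_def by auto
  have irr: "(a, a) \<notin> E" for a
    using E(3) unfolding girth_ge5_def by blast
  interpret pair_graph ?G
  proof
    show "finite (parcs ?G)"
      using E(1) by (simp add: finite_subset)
    show "symmetric (with_proj ?G)"
      using E(2) by (simp add: symmetric_def)
    show "fst e \<noteq> snd e" if "e \<in> parcs ?G" for e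
      using that irr by (cases e) auto
  qed (use E(1) in auto)
  have "pair_graph ?G" ..
  moreover have "regular 3"
    using E(4) by (simp add: regular_def out_degree_card)
  moreover have "girth = enat 5"
    using girth_eq_5 E by simp
  moreover have "diameter = enat d"
  proof (rule antisym)
    show "diameter \<le> enat d"
      using E(6) by (simp add: diameter_le_iff)
    obtain f u v where f: "lipschitz E f" "u < n" "v < n" "f u = 0" "f v = d"
      using assms unfolding cubic_graph_def by blast
    show "enat d \<le> diameter"
    proof (rule ccontr)
      assume "\<not> enat d \<le> diameter"
      then have lt: "diameter < enat d" by simp
      then obtain k where "diameter = enat k" "k < d"
        by (metis enat_iless enat_ord_simps(2))
      then have "near E k u v"
        using f diameter_le_iff[of k] by simp
      then show False
        using lipschitz_relpow[OF f(1)] f \<open>k < d\<close> unfolding near_def by fastforce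
    qed
  qed
  ultimately have "min_order 3 5 d \<le> enat (card (pverts ?G))"
    unfolding min_order_def by (intro INF_lower) simp
  then show ?thesis by simp
qed

lemma cubic_layers_gdist:
  fixes G :: "'a :: linorder pair_pre_digraph"
  assumes "pair_graph G" and "pre_digraph.regular (with_proj G) 3"
    and "pre_digraph.girth (with_proj G) = enat 5" and "pre_digraph.diameter (with_proj G) = enat d"
  obtains l where "cubic_layers (pverts G) (parcs G) l d"
proof -
  interpret pair_graph G by (rule assms(1))
  \<comment> \<open>The empty graph has infinite girth. Nonemptiness supplies the diametral pair
    when d = 0.\<close>
  have ne: "pverts G \<noteq> {}"
  proof
    assume "pverts G = {}"
    then have "cycle p \<Longrightarrow> False" for p
      by (auto simp: cycle_def awalk_def)
    then have "{p. cycle p \<and> 3 \<le> length p} = {}" by blast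
    then have "girth = \<infinity>"
      unfolding girth_def by (simp only: image_empty Inf_empty) (simp add: top_enat_def)
    then show False using assms(3) by simp
  qed
  have near: "near (parcs G) d u v" if "u \<in> pverts G" "v \<in> pverts G" for u v
    using that diameter_le_iff[of d] assms(4) by simp
  obtain x y where xy: "x \<in> pverts G" "y \<in> pverts G" "enat d \<le> gdist x y"
  proof (cases d)
    case 0
    then show ?thesis using ne that by (auto simp: enat_0)
  next
    case (Suc k)
    \<comment> \<open>The supremum is attained: as it exceeds k = d - 1, some pair has distance at
      least d.\<close>
    have "\<not> diameter \<le> enat k" using assms(4) Suc by simp
    then obtain x y where "x \<in> pverts G" "y \<in> pverts G" "\<not> near (parcs G) k x y"
      unfolding diameter_le_iff by blast
    then have "\<not> gdist x y \<le> enat k" using gdist_le_iff by blast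
    then have "enat d \<le> gdist x y"
      using Suc by (metis eSuc_enat ileI1 not_le)
    then show ?thesis using that \<open>x \<in> pverts G\<close> \<open>y \<in> pverts G\<close> by blast
  qed
  \<comment> \<open>On vertices the distance is at most d, hence finite, so \<open>the_enat\<close>
    loses nothing.\<close>
  define l where "l v = the_enat (gdist x v)" for v
  have l: "gdist x v = enat (l v)" "l v \<le> d" if "v \<in> pverts G" for v
  proof -
    have "gdist x v \<le> enat d" using near gdist_le_iff xy(1) that by blast
    then show "gdist x v = enat (l v)" "l v \<le> d"
      unfolding l_def by (metis enat_ile the_enat.simps, metis enat_ile enat_ord_simps(1) the_enat.simps)
  qed
  have le_iff: "l v \<le> k \<longleftrightarrow> near (parcs G) k x v" if "v \<in> pverts G" for v k
    using gdist_le_iff[OF xy(1), of v k] l(1)[OF that] by simp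
  have sym: "sym (parcs G)"
    using pair_sym_arcs by (simp add: symmetric_def)
  have "cubic_layers (pverts G) (parcs G) l d"
  proof
    show "finite (pverts G)" by simp
    show "parcs G \<subseteq> pverts G \<times> pverts G" using in_arcsD1 in_arcsD2 by auto
    show "sym (parcs G)" by (rule sym)
    show "girth_ge5 (parcs G)" using girth_ge5_parcs assms(3) .
    show "card (parcs G `` {v}) = 3" if "v \<in> pverts G" for v
      using assms(2) that by (simp add: regular_def out_degree_card)
    show "l u \<le> Suc (l v)" if "(u, v) \<in> parcs G" for u v
    proof -
      have uv: "u \<in> pverts G" "v \<in> pverts G" using that in_arcsD1 in_arcsD2 by auto
      have "near (parcs G) (l v + 1) x u"
        using near_trans[OF iffD1[OF le_iff[OF uv(2)] order_refl] near_edge] that sym by (metis symD)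
      then show ?thesis using le_iff[OF uv(1)] by simp
    qed
    show "\<exists>u. (u, v) \<in> parcs G \<and> l u = i" if v: "v \<in> pverts G" "l v = Suc i" for v i
    proof -
      \<comment> \<open>The last step of a shortest walk from x to v starts at the required
        parent.\<close>
      obtain j where j: "j \<le> Suc i" "(x, v) \<in> parcs G ^^ j"
        using le_iff[OF v(1), of "Suc i"] v(2) unfolding near_def by auto
      have "j \<noteq> 0"
        using j(2) le_iff[OF v(1), of 0] v(2) by (cases j) auto
      then obtain k u where u: "j = Suc k" "(x, u) \<in> parcs G ^^ k" "(u, v) \<in> parcs G"
        using j(2) by (metis not0_implies_Suc relpow_Suc_E)
      have uV: "u \<in> pverts G" using u(3) in_arcsD1 by blast
      have "l u \<le> i"
        using le_iff[OF uV, of i] u j(1) unfolding near_def by auto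
      moreover have "near (parcs G) (l u + 1) x v"
        using near_trans[OF iffD1[OF le_iff[OF uV] order_refl] near_edge[OF u(3)]] .
      then have "Suc i \<le> l u + 1"
        using le_iff[OF v(1)] v(2) by metis
      ultimately show ?thesis using u(3) by (intro exI[of _ u]) simp
    qed
    show "l v \<le> d" if "v \<in> pverts G" for v using l that by blast
    show "\<exists>v \<in> pverts G. l v = d"
      using xy l[OF xy(2)] by (intro bexI[of _ y]) auto
  qed
  then show ?thesis by (rule that)
qed

lemma min_order_ge:
  assumes "\<And>V E l. cubic_layers (V :: nat set) E l d \<Longrightarrow> n \<le> card V"
  shows "enat n \<le> min_order 3 5 d"
  unfolding min_order_def
proof (rule INF_greatest)
  fix G :: "nat pair_pre_digraph"
  assume G: "G \<in> {G. pair_graph G \<and> pre_digraph.regular (with_proj G) 3 \<and>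
    pre_digraph.girth (with_proj G) = enat 5 \<and> pre_digraph.diameter (with_proj G) = enat d}"
  then interpret pair_graph G by blast
  obtain l where "cubic_layers (pverts G) (parcs G) l d"
    using G by (elim CollectE conjE cubic_layers_gdist)
  then show "enat n \<le> enat (card (pverts G))"
    using assms by simp
qed

section \<open>The minimum order\<close>

lemma length_graphs [simp]:
  "length petersen_minus_edge = 10"
  "length end11 = 11"
  "length end13 = 13"
  "length end19 = 19"
  "length end21 = 21"
  "length petersen = 10"
  "length graph12 = 12"
  "length graph14 = 14"
  "length graph20 = 20"
  "length graph22 = 22"
  by (simp_all add: petersen_minus_edge_def end11_def end13_def end19_def end21_def
      petersen_def graph12_def graph14_def graph20_def graph22_def)

text \<open>Each copy of the Petersen graph minus an edge adds 10 vertices and, with its bridge, 4 +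
  1 to the diameter.\<close>

lemma pendant_add_blocks:
  assumes "pendant m e E"
  shows "\<exists>F. pendant (m + 10 * k) (e + 5 * k) F"
proof (induction k)
  case 0
  then show ?case using assms by auto
next
  case (Suc k)
  then obtain F where F: "pendant (m + 10 * k) (e + 5 * k) F" by blast
  have "\<exists>F'. pendant (10 + (m + 10 * k)) (4 + (e + 5 * k) + 1) F'"
    using pendant_prepend_block[OF _ _ F, of petersen_minus_edge] certified_petersen_minus_edge
    by fastforce
  moreover have "10 + (m + 10 * k) = m + 10 * Suc k" "4 + (e + 5 * k) + 1 = e + 5 * Suc k"
    by simp_all
  ultimately show ?case by metis
qed

lemma min_order_le_bridge:
  assumes "pendant n a A" "pendant m b B" "d = a + b + 1 + 5 * k"
  shows "min_order 3 5 d \<le> enat (n + m + 10 * k)"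
proof -
  obtain F where "pendant (m + 10 * k) (b + 5 * k) F"
    using pendant_add_blocks[OF assms(2)] by blast
  from min_order_le[OF cubic_graph_bridge[OF assms(1) this]]
  show ?thesis using assms(3) by (simp add: ac_simps)
qed

lemma pendant_ends:
  "\<exists>E. pendant 11 3 E" "\<exists>E. pendant 13 4 E" "\<exists>E. pendant 19 6 E" "\<exists>E. pendant 21 7 E"
  using pendant_adjacency_rel[OF certified_end11] pendant_adjacency_rel[OF certified_end13]
    pendant_adjacency_rel[OF certified_end19] pendant_adjacency_rel[OF certified_end21]
  by auto

lemma min_order_le_small:
  "min_order 3 5 2 \<le> enat 10" "min_order 3 5 3 \<le> enat 12" "min_order 3 5 4 \<le> enat 14"
  "min_order 3 5 5 \<le> enat 20" "min_order 3 5 6 \<le> enat 22"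
  using min_order_le[OF cubic_graph_adjacency_rel[OF certified_petersen]]
    min_order_le[OF cubic_graph_adjacency_rel[OF certified_graph12]]
    min_order_le[OF cubic_graph_adjacency_rel[OF certified_graph14]]
    min_order_le[OF cubic_graph_adjacency_rel[OF certified_graph20]]
    min_order_le[OF cubic_graph_adjacency_rel[OF certified_graph22]]
  by simp_all

text \<open>The ends with 11 and 19 vertices give diameter 3 + 6 + 1 = 10 and order 30; those with
  11 and 21 give 3 + 7 + 1 = 11 and 32. Blocks reach all larger d, and d = 5, 6 have explicit
  graphs.\<close>

lemma min_order_le_mod01:
  assumes "d \<ge> 5" "d mod 5 \<in> {0, 1}"
  shows "min_order 3 5 d \<le> enat (2 * d + 10)"
proof -
  obtain E11 E19 E21 where E: "pendant 11 3 E11" "pendant 19 6 E19" "pendant 21 7 E21"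
    using pendant_ends by blast
  consider "d = 5" | "d = 6" | k where "d = 10 + 5 * k" | k where "d = 11 + 5 * k"
  proof -
    have "d = 5 \<or> d = 6 \<or> d = 10 + 5 * (d div 5 - 2) \<or> d = 11 + 5 * (d div 5 - 2)"
      using assms by (auto; presburger)
    then show ?thesis using that by blast
  qed
  then show ?thesis
  proof cases
    case 1
    then show ?thesis using min_order_le_small(4) by simp
  next
    case 2
    then show ?thesis using min_order_le_small(5) by simp
  next
    case (3 k)
    then show ?thesis using min_order_le_bridge[OF E(1,2), of d k] by simp
  next
    case (4 k)
    then show ?thesis using min_order_le_bridge[OF E(1,3), of d k] by simp
  qed
qed

text \<open>The end pairs 11 + 11, 11 + 13 and 13 + 13 give diameters 7, 8, 9 and orders 22, 24, 26;
  blocks do the rest.\<close>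

lemma min_order_le_mod234:
  assumes "d \<ge> 5" "d mod 5 \<in> {2, 3, 4}"
  shows "min_order 3 5 d \<le> enat (2 * d + 8)"
proof -
  obtain E11 E13 where E: "pendant 11 3 E11" "pendant 13 4 E13"
    using pendant_ends by blast
  define k where "k = d div 5 - 1"
  have "d = 5 + 5 * k + d mod 5"
    using assms(1) by (auto simp: k_def) presburger
  then consider "d = 7 + 5 * k" | "d = 8 + 5 * k" | "d = 9 + 5 * k"
    using assms(2) by auto
  then show ?thesis
  proof cases
    case 1
    then show ?thesis using min_order_le_bridge[OF E(1,1), of d k] by simp
  next
    case 2
    then show ?thesis using min_order_le_bridge[OF E(1,2), of d k] by simp
  next
    case 3
    then show ?thesis using min_order_le_bridge[OF E(2,2), of d k] by simp
  qed
qed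

lemma min_order_le_short:
  assumes "2 \<le> d" "d \<le> 4"
  shows "min_order 3 5 d \<le> enat (2 * d + 6)"
proof -
  consider "d = 2" | "d = 3" | "d = 4" using assms by linarith
  then show ?thesis
    using min_order_le_small by cases simp_all
qed

theorem proposition8:
  fixes d :: nat
  shows "(d \<ge> 5 \<longrightarrow>
            (d mod 5 \<in> {0, 1} \<longrightarrow> min_order 3 5 d = enat (2 * d + 10)) \<and>
            (d mod 5 \<in> {2, 3, 4} \<longrightarrow> min_order 3 5 d = enat (2 * d + 8))) \<and>
         (2 \<le> d \<and> d \<le> 4 \<longrightarrow> min_order 3 5 d = enat (2 * d + 6))"
proof (intro conjI impI)
  assume "5 \<le> d" "d mod 5 \<in> {0, 1}"
  then show "min_order 3 5 d = enat (2 * d + 10)"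
    by (intro antisym min_order_le_mod01 min_order_ge cubic_layers.order_ge_mod01)
next
  assume "5 \<le> d" "d mod 5 \<in> {2, 3, 4}"
  then show "min_order 3 5 d = enat (2 * d + 8)"
    by (intro antisym min_order_le_mod234 min_order_ge cubic_layers.order_ge_mod234)
next
  assume "2 \<le> d \<and> d \<le> 4"
  then show "min_order 3 5 d = enat (2 * d + 6)"
    by (intro antisym min_order_le_short min_order_ge cubic_layers.order_ge_short) simp_all
qed

end
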